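(* Let $n\ge 1$ be an integer and let $\mathcal{G}_n$ be the set of general lattice paths from $(0,0)$ to $(n,n)$. Then the parameter "active set" on $\mathcal{G}_n$ is uniformly distributed over all subsets of $[n-1]=\{1,2,\ldots,n-1\}$: for every subset $S\subseteq[n-1]$, the number of paths $\pi\in\mathcal{G}_n$ whose active set equals $S$ is the same (i.e. independent of $S$).
   Context: A general lattice path is a finite sequence of steps, each step lying in $\mathbb{N}\times\mathbb{N}\setminus\{(0,0)\}$ (i.e. $(i,j)$ with $i,j$ nonnegative integers not both $0$). A path starting at $(0,0)$ has as vertices $(0,0)$ and the successive partial sums of its steps; consecutive vertices are joined by line segments. A subpath of a path $\pi$ is a subsequence of consecutive steps of $\pi$ (so it starts at some vertex of $\pi$ and ends at a later vertex); it is nonempty if it has at least one step. A path is balanced if its terminal vertex lies on the line of slope $1$ through its initial vertex. A path is subdiagonal if it never rises above the line of slope $1$ through its initial vertex, and superdiagonal if it never falls below the line of slope $1$ through its initial vertex. For $\pi\in\mathcal{G}_n$ and $1\le k\le n-1$, the vertical line $x=k$ is active for $\pi$ if it contains a vertex $V$ of $\pi$ such that (i) $V$ lies on the line $y=x$, or (ii) $V$ lies strictly below $y=x$ and $V$ is the initial vertex of a nonempty balanced subdiagonal subpath of $\pi$, or (iii) $V$ lies strictly above $y=x$ and $V$ is the terminal vertex of a nonempty balanced superdiagonal subpath of $\pi$. The active set of $\pi$ is $\{k\in[n-1]: x=k \text{ is active for } \pi\}$. *)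

theory Defs
  imports "HOL-Analysis.Analysis"
begin

text \<open>A path is represented by its list of steps; sums of steps are componentwise.\<close>

type_synonym point = "nat \<times> nat"
type_synonym lpath = "point list"

definition general_lattice_path :: "lpath \<Rightarrow> bool" where
  "general_lattice_path p \<longleftrightarrow> (0, 0) \<notin> set p"

definition general_paths :: "nat \<Rightarrow> lpath set" where
  "general_paths n = {p. general_lattice_path p \<and> sum_list p = (n, n)}"

definition vertices :: "lpath \<Rightarrow> point set" where
  "vertices p = {sum_list (take i p) | i. i \<le> length p}"

text \<open>The subpath of \<open>p\<close> with step list \<open>q\<close> and initial vertex \<open>V\<close>; the same list \<open>q\<close> may occur
  in \<open>p\<close> at several vertices.\<close>

definition subpath_at :: "lpath \<Rightarrow> point \<Rightarrow> lpath \<Rightarrow> bool" where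
  "subpath_at p V q \<longleftrightarrow> (\<exists>p1 p2. p = p1 @ q @ p2 \<and> V = sum_list p1)"

definition terminal_vertex :: "point \<Rightarrow> lpath \<Rightarrow> point" where
  "terminal_vertex V q = V + sum_list q"

definition real_point :: "point \<Rightarrow> real \<times> real" where
  "real_point V = (real (fst V), real (snd V))"

text \<open>The points of the plane on the path that starts at the given vertex, line segments
  included.\<close>

fun path_trace :: "point \<Rightarrow> lpath \<Rightarrow> (real \<times> real) set" where
  "path_trace V [] = {real_point V}"
| "path_trace V (s # q) = closed_segment (real_point V) (real_point (V + s)) \<union> path_trace (V + s) q"

text \<open>The line of slope \<open>1\<close> through \<open>V\<close> is \<open>y = diagonal V x\<close>.\<close>

definition diagonal :: "point \<Rightarrow> real \<Rightarrow> real" where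
  "diagonal V x = real (snd V) + (x - real (fst V))"

definition balanced :: "point \<Rightarrow> lpath \<Rightarrow> bool" where
  "balanced V q \<longleftrightarrow> (case real_point (terminal_vertex V q) of (x, y) \<Rightarrow> y = diagonal V x)"

definition subdiagonal :: "point \<Rightarrow> lpath \<Rightarrow> bool" where
  "subdiagonal V q \<longleftrightarrow> (\<forall>(x, y) \<in> path_trace V q. y \<le> diagonal V x)"

definition superdiagonal :: "point \<Rightarrow> lpath \<Rightarrow> bool" where
  "superdiagonal V q \<longleftrightarrow> (\<forall>(x, y) \<in> path_trace V q. y \<ge> diagonal V x)"

definition active_line :: "lpath \<Rightarrow> nat \<Rightarrow> bool" where
  "active_line p k \<longleftrightarrow> (\<exists>V \<in> vertices p. fst V = k \<and>
     (snd V = fst V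
      \<or> snd V < fst V \<and>
          (\<exists>q. subpath_at p V q \<and> q \<noteq> [] \<and> balanced V q \<and> subdiagonal V q)
      \<or> snd V > fst V \<and>
          (\<exists>U q. subpath_at p U q \<and> terminal_vertex U q = V \<and>
             q \<noteq> [] \<and> balanced U q \<and> superdiagonal U q)))"

definition active_set :: "nat \<Rightarrow> lpath \<Rightarrow> nat set" where
  "active_set n p = {k \<in> {1..n - 1}. active_line p k}"

text \<open>The set of paths is finite, so \<open>card\<close> counts its subsets faithfully.\<close>

lemma length_le_sum_list:
  "general_lattice_path p \<Longrightarrow> length p \<le> fst (sum_list p) + snd (sum_list p)"
proof (induction p)
  case (Cons s p)
  then have "s \<noteq> (0, 0)" "general_lattice_path p"
    by (auto simp: general_lattice_path_def)
  then show ?case using Cons.IH by (cases s) auto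
qed simp

lemma set_le_sum_list:
  fixes p :: lpath
  shows "s \<in> set p \<Longrightarrow> fst s \<le> fst (sum_list p) \<and> snd s \<le> snd (sum_list p)"
  by (induction p) auto

lemma finite_general_paths: "finite (general_paths n)"
proof (rule finite_subset)
  show "general_paths n \<subseteq> {p. set p \<subseteq> {..n} \<times> {..n} \<and> length p \<le> n + n}"
    using length_le_sum_list set_le_sum_list
    by (fastforce simp: general_paths_def)
  show "finite {p. set p \<subseteq> {..n} \<times> {..n} \<and> length p \<le> n + n}"
    by (rule finite_lists_length_le) simp
qed

end

theory Submission imports Defs begin

text \<open>
  Write the level of a vertex for its ordinate minus its abscissa. It suffices to fix a column \<open>k\<close>
  and to compare the paths on which \<open>k\<close> is active with those on which it is not, for prescribed
  activity of all other columns.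

  Let the top vertex \<open>V\<close> of column \<open>k\<close> lie below the diagonal. It is inactive iff the first later
  vertex that is not on a lower level overshoots the level of \<open>V\<close>, and inserting the point skipped by the
  overshooting step makes \<open>V\<close> active. This matches the inactive \<open>V\<close> with those active \<open>V\<close> whose
  return vertex is followed by a vertical step. In the remaining active case, and if \<open>V\<close> is on the
  diagonal, interchanging the vertical run of column \<open>k\<close> with the excursion after \<open>V\<close>, and dropping
  \<open>V\<close>, gives exactly the paths that jump over column \<open>k\<close> from a height at most \<open>k\<close>. Neither move
  affects another column, except that the second one must not be applied when it drops an isolated
  \<open>(k, k)\<close> between two vertices above the diagonal.

  Rotation by a half turn treats the paths that are above the diagonal at column \<open>k\<close>. Paths counted
  twice, and paths whose column \<open>k\<close> crosses the diagonal, are balanced by inserting or deleting the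
  vertex \<open>(k, k)\<close>.
\<close>

section \<open>Paths as lists of vertices\<close>

type_synonym ipoint = "int \<times> int"

definition lev :: "ipoint \<Rightarrow> int" where "lev z = snd z - fst z"

lemma lev_Pair [simp]: "lev (x, y) = y - x"
  by (simp add: lev_def)

text \<open>\<open>lt u v\<close> says that \<open>v - u\<close> is a legal step. As the relation is
  transitive, sortedness of a vertex list amounts to all consecutive differences being legal
  steps.\<close>

definition lt :: "ipoint \<Rightarrow> ipoint \<Rightarrow> bool" where
  "lt u v \<longleftrightarrow> fst u \<le> fst v \<and> snd u \<le> snd v \<and> u \<noteq> v"

definition vpaths :: "int \<Rightarrow> ipoint list set" where
  "vpaths n = {L. L \<noteq> [] \<and> hd L = (0, 0) \<and> last L = (n, n) \<and> sorted_wrt lt L}"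

text \<open>Condition (ii) at a vertex \<open>V\<close> only depends on the vertices after \<open>V\<close>: the first one whose
  level is at least that of \<open>V\<close> must be at the same level. Condition (iii) is the mirror image and is
  tested on the reversed list of the vertices before \<open>V\<close>.\<close>

fun rises_to :: "int \<Rightarrow> ipoint list \<Rightarrow> bool" where
  "rises_to l [] = False"
| "rises_to l (z # zs) = (if lev z < l then rises_to l zs else lev z = l)"

fun falls_to :: "int \<Rightarrow> ipoint list \<Rightarrow> bool" where
  "falls_to l [] = False"
| "falls_to l (z # zs) = (if lev z > l then falls_to l zs else lev z = l)"

text \<open>The second argument of \<open>below_cols\<close> is the part of the path after \<open>X\<close>; the first argument of
  \<open>above_cols\<close> is the part before \<open>X\<close>, reversed.\<close>

fun below_cols :: "ipoint list \<Rightarrow> ipoint list \<Rightarrow> int set" where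
  "below_cols [] Y = {}"
| "below_cols (z # X) Y = (if lev z < 0 \<and> rises_to (lev z) (X @ Y) then {fst z} else {}) \<union> below_cols X Y"

fun above_cols :: "ipoint list \<Rightarrow> ipoint list \<Rightarrow> int set" where
  "above_cols Z [] = {}"
| "above_cols Z (z # X) = (if lev z > 0 \<and> falls_to (lev z) Z then {fst z} else {}) \<union> above_cols (z # Z) X"

definition diag_cols :: "ipoint list \<Rightarrow> int set" where
  "diag_cols X = fst ` {z \<in> set X. lev z = 0}"

definition active_cols :: "ipoint list \<Rightarrow> int set" where
  "active_cols L = diag_cols L \<union> below_cols L [] \<union> above_cols [] L"

section \<open>Locality: which other vertices can influence the activity of a column\<close>

lemma below_append: "below_cols (X @ Y) Z = below_cols X (Y @ Z) \<union> below_cols Y Z"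
  by (induction X) auto

lemma above_append: "above_cols Z (X @ Y) = above_cols Z X \<union> above_cols (rev X @ Z) Y"
  by (induction X arbitrary: Z) auto

lemma dia_simps [simp]:
  "diag_cols [] = {}" "diag_cols (z # X) = (if lev z = 0 then {fst z} else {}) \<union> diag_cols X"
  "diag_cols (X @ Y) = diag_cols X \<union> diag_cols Y"
  by (auto simp: diag_cols_def)

lemma ret_append_skip: "(\<And>z. z \<in> set X \<Longrightarrow> lev z < l) \<Longrightarrow> rises_to l (X @ Y) = rises_to l Y"
  by (induction X) auto

text \<open>A search that runs through all of \<open>X\<close> fails at \<open>hd E\<close>, which
  lies above level \<open>l\<close>. This agrees with the value \<open>False\<close> that
  \<open>rises_to\<close> takes on the empty list.\<close>

lemma ret_append_overshoot: "E \<noteq> [] \<Longrightarrow> lev (hd E) > l \<Longrightarrow> rises_to l (X @ E) = rises_to l X"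
  by (induction X) (auto simp: neq_Nil_conv)

lemma ret_append_cong:
  "rises_to l Y = rises_to l Y' \<Longrightarrow> rises_to l (X @ Y) = rises_to l (X @ Y')"
  by (induction X) auto

text \<open>A search that started earlier in \<open>X\<close> and gets past \<open>last X\<close>
  has found that vertex on a lower level, and a search starting at \<open>last X\<close> has exactly
  its level. So \<open>Y\<close> is consulted only for levels from \<open>lev (last X)\<close>
  upwards.\<close>

lemma below_cong:
  assumes "X \<noteq> []" "\<And>l. l < 0 \<Longrightarrow> lev (last X) \<le> l \<Longrightarrow> rises_to l Y = rises_to l Y'"
  shows "below_cols X Y = below_cols X Y'"
proof -
  \<comment> \<open>\<open>X2\<close> stands for the vertices of \<open>X\<close> after the tested
    one; it is empty exactly when the tested vertex is \<open>last X\<close>.\<close>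
  have "rises_to l (X2 @ Y) = rises_to l (X2 @ Y')" if "X2 = [] \<Longrightarrow> lev (last X) \<le> l" "l < 0"
    "X2 \<noteq> [] \<Longrightarrow> last X2 = last X" for X2 l
    using that
  proof (induction X2)
    case Nil
    then show ?case using assms(2) by auto
  next
    case (Cons z X2)
    then show ?case
      using assms(2)[of l] by (cases "X2 = []") auto
  qed
  with assms(1) show ?thesis
  proof (induction X)
    case (Cons z X)
    have "below_cols X Y = below_cols X Y'"
      using Cons by (cases "X = []") auto
    moreover have "lev z < 0 \<Longrightarrow> rises_to (lev z) (X @ Y) = rises_to (lev z) (X @ Y')"
      by (rule Cons.prems(2)) auto
    ultimately show ?case by auto
  qed simp
qed

text \<open>Mirror image of \<open>below_cong\<close>: a backward search enters \<open>Z\<close>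
  only after passing \<open>hd X\<close> or by starting there, hence only on levels up to
  \<open>lev (hd X)\<close>.\<close>

lemma above_cong:
  assumes "X \<noteq> []" "\<And>l. l > 0 \<Longrightarrow> l \<le> lev (hd X) \<Longrightarrow> falls_to l Z = falls_to l Z'"
  shows "above_cols Z X = above_cols Z' X"
proof -
  have *: "above_cols Z X = above_cols Z' X" if "\<And>l. l > 0 \<Longrightarrow> falls_to l Z = falls_to l Z'" for Z Z' X
    using that
  proof (induction X arbitrary: Z Z')
    case (Cons z X)
    have "above_cols (z # Z) X = above_cols (z # Z') X"
      by (rule Cons.IH) (use Cons.prems in auto)
    then show ?case using Cons.prems by auto
  qed simp
  obtain z X' where X: "X = z # X'" using assms(1) by (cases X) auto
  have "above_cols (z # Z) X' = above_cols (z # Z') X'"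
    by (rule *) (use assms X in auto)
  then show ?thesis using assms X by auto
qed

text \<open>A vertex on or below the diagonal ends every backward search on a positive level without
  success.\<close>

lemma above_cong_nonpos:
  assumes "Z \<noteq> []" "Z' \<noteq> []" "lev (hd Z) \<le> 0" "lev (hd Z') \<le> 0"
  shows "above_cols Z X = above_cols Z' X"
proof (cases "X = []")
  case False
  then show ?thesis
    by (rule above_cong) (use assms in \<open>auto simp: neq_Nil_conv\<close>)
qed simp

lemma above_nonpos: "(\<And>z. z \<in> set X \<Longrightarrow> lev z \<le> 0) \<Longrightarrow> above_cols Z X = {}"
  by (induction X arbitrary: Z) force+

text \<open>Since \<open>hd E\<close> overshoots every vertex of \<open>X\<close>, a return can only
  happen inside \<open>X\<close>.\<close>

lemma below_cut:
  assumes "E \<noteq> []" "\<And>z. z \<in> set X \<Longrightarrow> lev z < lev (hd E)"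
  shows "below_cols X E = below_cols X []"
  using assms by (induction X) (auto simp: ret_append_overshoot)

text \<open>Each vertex is followed immediately by one on a strictly higher level, so every search
  overshoots at once.\<close>

lemma below_increasing:
  assumes "sorted_wrt (\<lambda>u v. lev u < lev v) X"
    "E \<noteq> []" "\<And>z. z \<in> set X \<Longrightarrow> lev z < lev (hd E)"
  shows "below_cols X E = {}"
proof -
  have "below_cols X [] = {}" using assms(1)
  proof (induction X)
    case (Cons z X)
    then show ?case by (cases X) auto
  qed simp
  with below_cut[OF assms(2,3)] show ?thesis by simp
qed

lemma below_subset: "below_cols X Y \<subseteq> fst ` set X"
  by (induction X) auto

lemma above_subset: "above_cols Z X \<subseteq> fst ` set X"
  by (induction X arbitrary: Z) auto

lemma dia_subset: "diag_cols X \<subseteq> fst ` set X"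
  by (auto simp: diag_cols_def)

lemma acts_subset: "active_cols L \<subseteq> fst ` set L"
  using below_subset above_subset dia_subset unfolding active_cols_def by blast

definition shift :: "int \<Rightarrow> int \<Rightarrow> ipoint \<Rightarrow> ipoint" where
  "shift a b z = (fst z + a, snd z + b)"

lemma shift_simps [simp]:
  "fst (shift a b z) = fst z + a" "snd (shift a b z) = snd z + b"
  "lev (shift a b z) = lev z + b - a"
  by (simp_all add: shift_def lev_def)

lemma ret_map_shift: "rises_to (l + t) (map (shift 0 t) X) = rises_to l X"
  by (induction X) auto

lemma below_map_shift:
  assumes "\<And>z. z \<in> set X \<Longrightarrow> lev z < 0" "t \<le> 0"
  shows "below_cols (map (shift 0 t) X) [] = below_cols X []"
  using assms(1)
proof (induction X)
  case (Cons z X)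
  have "lev z < 0" "lev z + t < 0" using Cons.prems[of z] assms(2) by auto
  then show ?case using Cons by (simp add: ret_map_shift)
qed simp

section \<open>Signed counting by pairs of paths that differ only in the activity of column
  \<open>k\<close>\<close>

definition toggle :: "int \<Rightarrow> ipoint list \<Rightarrow> ipoint list \<Rightarrow> bool" where
  "toggle k L L' \<longleftrightarrow> k \<in> active_cols L \<and> active_cols L' = active_cols L - {k}"

text \<open>Summed over all paths, the weight gives the difference of the numbers of paths with active
  columns \<open>insert k T\<close> and \<open>T\<close>.\<close>

definition weight :: "int \<Rightarrow> int set \<Rightarrow> ipoint list \<Rightarrow> int" where
  "weight k T L = of_bool (active_cols L = insert k T) - of_bool (active_cols L = T)"

lemma wt_toggle: "k \<notin> T \<Longrightarrow> toggle k L L' \<Longrightarrow> weight k T L + weight k T L' = 0"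
  unfolding weight_def toggle_def by (auto simp: of_bool_def)

lemma sum_wt_toggle:
  assumes "k \<notin> T" "inj_on f X" "inj_on g X" "\<And>t. t \<in> X \<Longrightarrow> toggle k (f t) (g t)"
  shows "sum (weight k T) (f ` X) + sum (weight k T) (g ` X) = 0"
  using assms by (simp add: sum.reindex o_def wt_toggle flip: sum.distrib)

section \<open>Columns and configurations\<close>

definition lo :: "int \<Rightarrow> ipoint list \<Rightarrow> ipoint list" where "lo k L = filter (\<lambda>z. fst z < k) L"
definition mid :: "int \<Rightarrow> ipoint list \<Rightarrow> ipoint list" where "mid k L = filter (\<lambda>z. fst z = k) L"
definition hi :: "int \<Rightarrow> ipoint list \<Rightarrow> ipoint list" where "hi k L = filter (\<lambda>z. fst z > k) L"

lemmas parts_def = lo_def mid_def hi_def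

lemma split_parts: "sorted_wrt lt L \<Longrightarrow> L = lo k L @ mid k L @ hi k L"
proof (induction L)
  case (Cons z L)
  then have IH: "L = lo k L @ mid k L @ hi k L" by simp
  have "lo k L = []" if "fst z \<ge> k"
    using that Cons.prems by (fastforce simp: parts_def filter_empty_conv lt_def)
  moreover have "mid k L = []" if "fst z > k"
    using that Cons.prems by (fastforce simp: parts_def filter_empty_conv lt_def)
  ultimately show ?case using IH
    by (cases "fst z < k"; cases "fst z = k") (auto simp: parts_def)
qed (simp add: parts_def)

lemma set_parts [simp]:
  "z \<in> set (lo k L) \<longleftrightarrow> z \<in> set L \<and> fst z < k"
  "z \<in> set (mid k L) \<longleftrightarrow> z \<in> set L \<and> fst z = k"
  "z \<in> set (hi k L) \<longleftrightarrow> z \<in> set L \<and> fst z > k"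
  by (auto simp: parts_def)

lemma parts_eqI:
  assumes "\<And>z. z \<in> set A \<Longrightarrow> fst z < k" "\<And>z. z \<in> set C \<Longrightarrow> fst z = k" "\<And>z. z \<in> set R \<Longrightarrow> fst z > k"
  shows "lo k (A @ C @ R) = A" "mid k (A @ C @ R) = C" "hi k (A @ C @ R) = R"
proof -
  have "filter (\<lambda>z. fst z < k) A = A" "filter (\<lambda>z. fst z = k) A = []" "filter (\<lambda>z. fst z > k) A = []"
    "filter (\<lambda>z. fst z < k) C = []" "filter (\<lambda>z. fst z = k) C = C" "filter (\<lambda>z. fst z > k) C = []"
    "filter (\<lambda>z. fst z < k) R = []" "filter (\<lambda>z. fst z = k) R = []" "filter (\<lambda>z. fst z > k) R = R"
    using assms by (force simp: filter_empty_conv filter_id_conv)+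
  then show "lo k (A @ C @ R) = A" "mid k (A @ C @ R) = C" "hi k (A @ C @ R) = R"
    by (simp_all add: parts_def)
qed

lemma sorted_le_last: "sorted_wrt lt L \<Longrightarrow> z \<in> set L \<Longrightarrow> fst z \<le> fst (last L) \<and> snd z \<le> snd (last L)"
  by (induction L) (auto simp: lt_def)

lemma sorted_ge_hd: "sorted_wrt lt L \<Longrightarrow> z \<in> set L \<Longrightarrow> fst (hd L) \<le> fst z \<and> snd (hd L) \<le> snd z"
  by (cases L) (auto simp: lt_def)

lemma vpaths_split:
  assumes "L \<in> vpaths n" "0 < k" "k < n"
  shows "L = lo k L @ mid k L @ hi k L" "lo k L \<noteq> []" "hi k L \<noteq> []"
    "hd (lo k L) = (0, 0)" "last (hi k L) = (n, n)"
proof -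
  have L: "L \<noteq> []" "hd L = (0, 0)" "last L = (n, n)" "sorted_wrt lt L"
    using assms by (auto simp: vpaths_def)
  show *: "L = lo k L @ mid k L @ hi k L" by (rule split_parts[OF L(4)])
  have "(0, 0) \<in> set (lo k L)" "(n, n) \<in> set (hi k L)"
    using L assms hd_in_set[OF L(1)] last_in_set[OF L(1)] by auto
  then show ne: "lo k L \<noteq> []" "hi k L \<noteq> []" by (metis empty_iff empty_set)+
  show "hd (lo k L) = (0, 0)" using * L(2) ne(1) by (metis hd_append2)
  show "last (hi k L) = (n, n)" using * L(3) ne(2) by (metis last_appendR append_assoc)
qed

section \<open>Decomposition of a path at the top vertex of column \<open>k\<close>\<close>

type_synonym config = "ipoint list \<times> ipoint list \<times> int \<times> ipoint list \<times> ipoint list"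

text \<open>\<open>(k, y)\<close> is the top vertex of column \<open>k\<close>, not above the diagonal, and \<open>us\<close> are the vertices
  below it in the column. The vertices \<open>bs\<close> form the excursion to lower levels, which ends at \<open>hd E\<close>.\<close>

fun cfg :: "int \<Rightarrow> int \<Rightarrow> config \<Rightarrow> bool" where
  "cfg n k (A, us, y, bs, E) \<longleftrightarrow>
     A \<noteq> [] \<and> hd A = (0, 0) \<and> sorted_wrt lt A \<and> (\<forall>z\<in>set A. fst z < k) \<and>
     snd (last A) \<le> y \<and> y \<le> k \<and>
     sorted_wrt lt us \<and> (\<forall>z\<in>set us. fst z = k \<and> snd (last A) \<le> snd z \<and> snd z < y) \<and>
     sorted_wrt lt bs \<and> (\<forall>z\<in>set bs. k < fst z \<and> fst z \<le> fst (hd E) \<and> y \<le> snd z \<and> lev z < y - k) \<and>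
     E \<noteq> [] \<and> last E = (n, n) \<and> sorted_wrt lt E \<and> k < fst (hd E) \<and> y - k \<le> lev (hd E)"

fun column_path :: "int \<Rightarrow> config \<Rightarrow> ipoint list" where
  "column_path k (A, us, y, bs, E) = A @ (us @ [(k, y)]) @ bs @ E"

text \<open>Interchanges the excursion with the vertical run of the column: \<open>bs\<close> moves down as if it
  started at the height of the last vertex before the column, and \<open>us\<close> moves along the diagonal to the column where the excursion
  returns, so all levels of \<open>us\<close> are kept. The vertex \<open>(k, y)\<close> is dropped.\<close>

fun skip_path :: "int \<Rightarrow> config \<Rightarrow> ipoint list" where
  "skip_path k (A, us, y, bs, E) =
     A @ map (shift 0 (snd (last A) - y)) bs @ map (shift (fst (hd E) - k) (fst (hd E) - k)) us @ E"

lemma sorted_map_shift: "sorted_wrt lt (map (shift a b) X) \<longleftrightarrow> sorted_wrt lt X"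
  by (simp add: sorted_wrt_map lt_def[abs_def] prod_eq_iff)

lemma cfgD:
  assumes "cfg n k (A, us, y, bs, E)"
  shows "z \<in> set A \<Longrightarrow> fst z < k \<and> snd z \<le> snd (last A)"
    "z \<in> set us \<Longrightarrow> fst z = k \<and> snd (last A) \<le> snd z \<and> snd z < y"
    "z \<in> set bs \<Longrightarrow> k < fst z \<and> fst z \<le> fst (hd E) \<and> y \<le> snd z \<and> snd z - fst z < y - k"
    "z \<in> set E \<Longrightarrow> fst (hd E) \<le> fst z \<and> snd (hd E) \<le> snd z"
    "A \<noteq> []" "E \<noteq> []" "snd (last A) \<le> y" "y \<le> k" "k < fst (hd E)"
    "y - k \<le> snd (hd E) - fst (hd E)" "fst (last A) < k"
  using assms sorted_le_last[of A z] sorted_ge_hd[of E z] by (auto simp: lev_def)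

lemma ltI:
  "fst u < fst v \<Longrightarrow> snd u \<le> snd v \<Longrightarrow> lt u v"
  "fst u \<le> fst v \<Longrightarrow> snd u < snd v \<Longrightarrow> lt u v"
  by (auto simp: lt_def)

lemma cfg_src_vpaths:
  assumes "cfg n k (A, us, y, bs, E)"
  shows "column_path k (A, us, y, bs, E) \<in> vpaths n"
proof -
  note c = assms[unfolded cfg.simps]
  note d = cfgD[OF assms]
  have 1: "lt u v" if "u \<in> set A" "v \<in> set us" for u v
    using d(1)[OF that(1)] d(2)[OF that(2)] by (intro ltI(1)) auto
  have 2: "lt u (k, y)" if "u \<in> set A" for u
    using d(1)[OF that(1)] d(7) by (intro ltI(1)) auto
  have 3: "lt u v" if "u \<in> set A" "v \<in> set bs" for u v
    using d(1)[OF that(1)] d(3)[OF that(2)] d(7) by (intro ltI(1)) auto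
  have 4: "lt u v" if "u \<in> set A" "v \<in> set E" for u v
    using d(1)[OF that(1)] d(4)[OF that(2)] d(7-) by (intro ltI(1)) auto
  have 5: "lt u (k, y)" if "u \<in> set us" for u
    using d(2)[OF that(1)] by (intro ltI(2)) auto
  have 6: "lt u v" if "u \<in> set us" "v \<in> set bs" for u v
    using d(2)[OF that(1)] d(3)[OF that(2)] by (intro ltI(1)) auto
  have 7: "lt u v" if "u \<in> set us" "v \<in> set E" for u v
    using d(2)[OF that(1)] d(4)[OF that(2)] d(7-) by (intro ltI(1)) auto
  have 8: "lt (k, y) v" if "v \<in> set bs" for v
    using d(3)[OF that(1)] by (intro ltI(1)) auto
  have 9: "lt (k, y) v" if "v \<in> set E" for v
    using d(4)[OF that(1)] d(7-) by (intro ltI(1)) auto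
  \<comment> \<open>A vertex of the excursion may share its column with \<open>hd E\<close>; its
    strictly lower level then places it strictly below.\<close>
  have 10: "lt u v" if "u \<in> set bs" "v \<in> set E" for u v
    using d(3)[OF that(1)] d(4)[OF that(2)] d(7-) by (intro ltI(2)) auto
  have "sorted_wrt lt (column_path k (A, us, y, bs, E))"
    using c 1 2 3 4 5 6 7 8 9 10 by (auto simp: sorted_wrt_append)
  then show ?thesis using c by (simp add: vpaths_def)
qed

lemma cfg_img_vpaths:
  assumes "cfg n k (A, us, y, bs, E)"
  shows "skip_path k (A, us, y, bs, E) \<in> vpaths n"
proof -
  note c = assms[unfolded cfg.simps]
  note d = cfgD[OF assms]
  let ?f = "shift 0 (snd (last A) - y)" and ?g = "shift (fst (hd E) - k) (fst (hd E) - k)"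
  have 1: "lt u (?g v)" if "u \<in> set A" "v \<in> set us" for u v
    using d(1)[OF that(1)] d(2)[OF that(2)] d(7-) by (intro ltI(1)) auto
  have 2: "lt u (?f v)" if "u \<in> set A" "v \<in> set bs" for u v
    using d(1)[OF that(1)] d(3)[OF that(2)] d(7) by (intro ltI(1)) auto
  have 3: "lt u v" if "u \<in> set A" "v \<in> set E" for u v
    using d(1)[OF that(1)] d(4)[OF that(2)] d(7-) by (intro ltI(1)) auto
  \<comment> \<open>The translated excursion stays below level \<open>snd (last A) - k\<close>,
    while \<open>us\<close> starts at or above this level. Moreover \<open>us\<close> now sits in
    the column of \<open>hd E\<close>, and no vertex of the excursion is to the right of that
    column.\<close>
  have 4: "lt (?f u) (?g v)" if "u \<in> set bs" "v \<in> set us" for u v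
    using d(2)[OF that(2)] d(3)[OF that(1)] by (intro ltI(2)) auto
  have 5: "lt (?g u) v" if "u \<in> set us" "v \<in> set E" for u v
    using d(2)[OF that(1)] d(4)[OF that(2)] d(7-) by (intro ltI(2)) auto
  have 6: "lt (?f u) v" if "u \<in> set bs" "v \<in> set E" for u v
    using d(3)[OF that(1)] d(4)[OF that(2)] d(7-) by (intro ltI(2)) auto
  have "sorted_wrt lt (skip_path k (A, us, y, bs, E))"
    using c 1 2 3 4 5 6 by (auto simp: sorted_wrt_append sorted_map_shift)
  then show ?thesis using c by (simp add: vpaths_def)
qed

lemma cfg_src_parts:
  assumes "cfg n k (A, us, y, bs, E)"
  shows "lo k (column_path k (A, us, y, bs, E)) = A" "mid k (column_path k (A, us, y, bs, E)) = us @ [(k, y)]"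
    "hi k (column_path k (A, us, y, bs, E)) = bs @ E"
proof -
  note d = cfgD[OF assms]
  have 1: "fst z < k" if "z \<in> set A" for z using d(1)[OF that] by simp
  have 2: "fst z = k" if "z \<in> set (us @ [(k, y)])" for z using d(2)[of z] that by auto
  have 3: "fst z > k" if "z \<in> set (bs @ E)" for z using d(3,4)[of z] d(9) that by auto
  show "lo k (column_path k (A, us, y, bs, E)) = A" "mid k (column_path k (A, us, y, bs, E)) = us @ [(k, y)]"
    "hi k (column_path k (A, us, y, bs, E)) = bs @ E"
    unfolding column_path.simps by (rule parts_eqI[OF 1 2 3]; assumption)+
qed

lemma cfg_img_parts:
  assumes "cfg n k (A, us, y, bs, E)"
  shows "lo k (skip_path k (A, us, y, bs, E)) = A" "mid k (skip_path k (A, us, y, bs, E)) = []"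
    "hi k (skip_path k (A, us, y, bs, E)) =
      map (shift 0 (snd (last A) - y)) bs @ map (shift (fst (hd E) - k) (fst (hd E) - k)) us @ E"
proof -
  note d = cfgD[OF assms]
  let ?R = "map (shift 0 (snd (last A) - y)) bs @ map (shift (fst (hd E) - k) (fst (hd E) - k)) us @ E"
  have *: "skip_path k (A, us, y, bs, E) = A @ [] @ ?R" by simp
  have 1: "fst z < k" if "z \<in> set A" for z using d(1)[OF that] by simp
  have 2: "fst z = k" if "z \<in> set []" for z :: ipoint using that by simp
  have 3: "fst z > k" if "z \<in> set ?R" for z
  proof -
    have "\<forall>u\<in>set bs. k < fst u" "\<forall>u\<in>set us. fst u = k" "\<forall>u\<in>set E. k < fst u"
      using d(2,3,4) d(9) by force+
    then show ?thesis using that d(9) by auto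
  qed
  show "lo k (skip_path k (A, us, y, bs, E)) = A" "mid k (skip_path k (A, us, y, bs, E)) = []"
    "hi k (skip_path k (A, us, y, bs, E)) = ?R"
    unfolding * by (rule parts_eqI[OF 1 2 3]; assumption)+
qed

lemma takeWhile_split:
  assumes "\<forall>z\<in>set X. P z" "Y \<noteq> []" "\<not> P (hd Y)"
  shows "takeWhile P (X @ Y) = X" "dropWhile P (X @ Y) = Y"
  using assms by (induction X) (auto simp: neq_Nil_conv)

text \<open>The columns up to \<open>k\<close> determine \<open>A\<close>, \<open>us\<close> and
  \<open>y\<close>; the excursion is then the longest initial piece of the remaining vertices below
  level \<open>y - k\<close>.\<close>

lemma cfg_src_inj: "inj_on (column_path k) {t. cfg n k t}"
proof (rule inj_onI, clarsimp simp del: cfg.simps column_path.simps)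
  fix A us y bs E A' us' y' bs' E'
  assume c: "cfg n k (A, us, y, bs, E)" and c': "cfg n k (A', us', y', bs', E')"
    and eq: "column_path k (A, us, y, bs, E) = column_path k (A', us', y', bs', E')"
  have A: "A = A'" and us: "us = us'" "y = y'" and R: "bs @ E = bs' @ E'"
    using cfg_src_parts[OF c] cfg_src_parts[OF c'] eq by auto
  let ?P = "\<lambda>z. lev z < y - k"
  have "takeWhile ?P (bs @ E) = bs" "dropWhile ?P (bs @ E) = E"
    by (rule takeWhile_split; use c in auto)+
  moreover have "takeWhile ?P (bs' @ E') = bs'" "dropWhile ?P (bs' @ E') = E'"
    by (rule takeWhile_split; use c' us in auto)+
  ultimately show "A = A' \<and> us = us' \<and> y = y' \<and> bs = bs' \<and> E = E'"
    using A us R by simp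
qed

lemma cfg_src_surj:
  assumes L: "L \<in> vpaths n" and k: "0 < k" "k < n" and m: "mid k L \<noteq> []" "lev (last (mid k L)) \<le> 0"
  obtains t where "cfg n k t" "L = column_path k t"
proof -
  define A where "A = lo k L"
  define us where "us = butlast (mid k L)"
  define y where "y = snd (last (mid k L))"
  define bs where "bs = takeWhile (\<lambda>z. lev z < y - k) (hi k L)"
  define E where "E = dropWhile (\<lambda>z. lev z < y - k) (hi k L)"
  note sp = vpaths_split[OF L k]
  have "last (mid k L) \<in> set (mid k L)" using m(1) by (rule last_in_set)
  then have "fst (last (mid k L)) = k" by (simp only: set_parts)
  then have V: "last (mid k L) = (k, y)" by (simp add: y_def prod_eq_iff)
  have mid: "mid k L = us @ [(k, y)]" using append_butlast_last_id[OF m(1)] by (simp only: us_def V)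
  have hi: "hi k L = bs @ E" by (simp add: bs_def E_def)
  have yk: "y \<le> k" using m V by simp
  have "(n, n) \<in> set (hi k L)" using sp(3,5) by (metis last_in_set)
  \<comment> \<open>The final vertex \<open>(n, n)\<close> has level 0, which is at least
    \<open>y - k\<close>, so the excursion does end.\<close>
  then have E: "E \<noteq> []" using yk
    by (auto simp: E_def dropWhile_eq_Nil_conv simp del: set_parts intro!: bexI[of _ "(n, n)"])
  have hdE: "y - k \<le> lev (hd E)" using hd_dropWhile[of "\<lambda>z. lev z < y - k" "hi k L"] E
    by (simp add: E_def)
  have Leq: "L = A @ (us @ [(k, y)]) @ bs @ E" by (rule sp(1)[unfolded mid hi, folded A_def])
  have s: "sorted_wrt lt (A @ (us @ [(k, y)]) @ bs @ E)" using L Leq by (simp add: vpaths_def)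
  have A: "\<forall>z\<in>set A. fst z < k" by (simp add: A_def)
  have us: "\<forall>z\<in>set us. fst z = k"
  proof
    fix z assume "z \<in> set us"
    then have "z \<in> set (mid k L)" unfolding mid by simp
    then show "fst z = k" by (simp only: set_parts)
  qed
  have bsE: "\<forall>z\<in>set (bs @ E). k < fst z" unfolding hi[symmetric] by simp
  have bsl: "\<forall>z\<in>set bs. lev z < y - k" unfolding bs_def by (auto dest: set_takeWhileD)
  have Ane: "A \<noteq> []" "last A \<in> set A" "hd A = (0, 0)" using sp(2,4) by (simp_all add: A_def del: set_parts)
  have hdE': "hd E \<in> set E" using E by simp
  have lE: "last E = (n, n)" using sp(5) hi E by simp
  have so: "sorted_wrt lt A" "sorted_wrt lt us" "sorted_wrt lt bs" "sorted_wrt lt E"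
    using s by (simp_all add: sorted_wrt_append)
  have us2: "\<forall>z\<in>set us. fst z = k \<and> snd (last A) \<le> snd z \<and> snd z < y"
  proof
    fix z assume z: "z \<in> set us"
    have "lt (last A) z" "lt z (k, y)" using s Ane z by (simp_all add: sorted_wrt_append)
    then show "fst z = k \<and> snd (last A) \<le> snd z \<and> snd z < y"
      using us z by (simp add: lt_def prod_eq_iff)
  qed
  have Ay: "lt (last A) (k, y)" using s Ane by (simp add: sorted_wrt_append)
  have bs2: "\<forall>z\<in>set bs. k < fst z \<and> fst z \<le> fst (hd E) \<and> y \<le> snd z \<and> lev z < y - k"
  proof
    fix z assume z: "z \<in> set bs"
    have "lt (k, y) z" "lt z (hd E)" using s hdE' z by (simp_all add: sorted_wrt_append)
    then show "k < fst z \<and> fst z \<le> fst (hd E) \<and> y \<le> snd z \<and> lev z < y - k"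
      using bsE bsl z by (simp add: lt_def)
  qed
  have "cfg n k (A, us, y, bs, E)"
    using so A us2 bs2 Ane hdE hdE' E yk lE bsE Ay by (simp add: lt_def)
  then show ?thesis
  proof (rule that)
    show "L = column_path k (A, us, y, bs, E)" unfolding column_path.simps by (rule Leq)
  qed
qed

section \<open>Effect of the two moves on the active columns\<close>

text \<open>The formula isolates the contribution of \<open>k\<close>. Going up the column the
  levels increase, so \<open>us\<close> contributes nothing, and the excursion is cut off by
  \<open>hd E\<close>. Backward searches from \<open>E\<close> stop at a vertex not above the
  diagonal, which \<open>(k, y)\<close> may represent whether or not \<open>bs\<close> is
  empty.\<close>

lemma acts_src:
  assumes c: "cfg n k (A, us, y, bs, E)"
  shows "active_cols (column_path k (A, us, y, bs, E)) =
    diag_cols A \<union> diag_cols E \<union> below_cols A (us @ (k, y) # bs @ E) \<union> below_cols bs [] \<union> below_cols E [] \<union>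
    above_cols [] A \<union> above_cols [(k, y)] E \<union> (if y = k \<or> lev (hd E) = y - k then {k} else {})"
proof -
  note d = cfgD[OF c]
  have bsl: "lev z < y - k" if "z \<in> set bs" for z using c that by simp
  have usl: "lev z < y - k" if "z \<in> set us" for z using d(2)[OF that] by (simp add: lev_def)
  have diag_cols: "diag_cols us = {}" "diag_cols bs = {}" using usl bsl d(8) by (fastforce simp: diag_cols_def)+
  have "sorted_wrt (\<lambda>u v. lev u < lev v) us"
    by (rule sorted_wrt_mono_rel[of _ lt]) (use c in \<open>auto simp: lt_def lev_def prod_eq_iff\<close>)
  then have us: "below_cols us ((k, y) # bs @ E) = {}" by (rule below_increasing) (use usl in auto)
  have bs: "below_cols bs E = below_cols bs []"
    by (rule below_cut) (use d bsl in \<open>force simp: lev_def\<close>)+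
  have "rises_to (y - k) (bs @ E) = rises_to (y - k) E" by (rule ret_append_skip) (use bsl in auto)
  also have "\<dots> \<longleftrightarrow> lev (hd E) = y - k" using d(6,10) by (cases E) (auto simp: lev_def)
  finally have V: "below_cols [(k, y)] (bs @ E) = (if y < k \<and> lev (hd E) = y - k then {k} else {})"
    by simp
  have ab: "above_cols Z us = {}" "above_cols Z' [(k, y)] = {}" "above_cols Z'' bs = {}" for Z Z' Z''
    by (rule above_nonpos, use usl bsl d(8) in force)+
  have abE: "above_cols (rev (us @ [(k, y)] @ bs) @ rev A) E = above_cols [(k, y)] E"
  proof (rule above_cong_nonpos)
    show "lev (hd (rev (us @ [(k, y)] @ bs) @ rev A)) \<le> 0"
    proof (cases bs rule: rev_cases)
      case (snoc bs' b)
      then show ?thesis using bsl[of b] d(8) by simp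
    qed (use d in simp)
  qed (use d in simp_all)
  show ?thesis
    using diag_cols us bs V ab abE d(8)
    by (auto simp: active_cols_def below_append above_append)
qed

text \<open>The terms are those of \<open>acts_src\<close>, except that \<open>k\<close> disappears
  and \<open>A\<close> sees a different continuation. Assumption \<open>nn\<close> prevents backward
  searches from \<open>E\<close> on positive levels from continuing into \<open>A\<close> once the
  column has been dropped.\<close>

lemma acts_img:
  assumes c: "cfg n k (A, us, y, bs, E)"
    and nn: "us \<noteq> [] \<or> bs \<noteq> [] \<or> lev (last A) \<le> 0 \<or> lev (hd E) \<le> 0"
  defines "bs' \<equiv> map (shift 0 (snd (last A) - y)) bs"
    and "us' \<equiv> map (shift (fst (hd E) - k) (fst (hd E) - k)) us"
  shows "active_cols (skip_path k (A, us, y, bs, E)) =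
    diag_cols A \<union> diag_cols E \<union> below_cols A (bs' @ us' @ E) \<union> below_cols bs [] \<union> below_cols E [] \<union>
    above_cols [] A \<union> above_cols [(k, y)] E"
proof -
  note d = cfgD[OF c]
  have bsl: "lev z < y - k" if "z \<in> set bs" for z using c that by simp
  have usl: "lev z < y - k \<and> snd (last A) - k \<le> lev z" if "z \<in> set us" for z using d(2)[OF that] by (simp add: lev_def)
  have bsl': "lev z < snd (last A) - k" if "z \<in> set bs'" for z using bsl that by (force simp: bs'_def)
  have usl': "lev z < y - k \<and> snd (last A) - k \<le> lev z" if "z \<in> set us'" for z
    using usl that by (force simp: us'_def)
  have diag_cols: "diag_cols us' = {}" "diag_cols bs' = {}" using usl' bsl' d(7,8) by (fastforce simp: diag_cols_def)+
  have "sorted_wrt lt us'" using c by (simp add: us'_def sorted_map_shift)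
  moreover have "fst z = fst (hd E)" if "z \<in> set us'" for z using that d(2) by (auto simp: us'_def)
  ultimately have "sorted_wrt (\<lambda>u v. lev u < lev v) us'"
    by (elim sorted_wrt_mono_rel[rotated]) (auto simp: lt_def lev_def prod_eq_iff)
  then have us: "below_cols us' E = {}"
    by (rule below_increasing) (use usl' d in \<open>force simp: lev_def\<close>)+
  have "lev z < lev (hd (us' @ E))" if "z \<in> set bs'" for z
    using bsl'[OF that] usl'[of "hd us'"] d(7,10) by (cases us') (auto simp: lev_def)
  then have "below_cols bs' (us' @ E) = below_cols bs' []"
    by (intro below_cut) (use d in auto)
  also have "\<dots> = below_cols bs []" unfolding bs'_def
    by (rule below_map_shift) (use bsl d in force)+
  finally have bs: "below_cols bs' (us' @ E) = below_cols bs []" .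
  have ab: "above_cols Z us' = {}" "above_cols Z' bs' = {}" for Z Z'
    by (rule above_nonpos, use usl' bsl' d(7,8) in force)+
  have abE: "above_cols (rev us' @ rev bs' @ rev A) E = above_cols [(k, y)] E"
  proof (cases "us = [] \<and> bs = [] \<and> lev (last A) > 0")
    case True
    \<comment> \<open>Now \<open>last A\<close> is directly before \<open>E\<close> and above the
      diagonal, but \<open>above_cong\<close> has no positive level to compare because
      \<open>hd E\<close> is not above the diagonal.\<close>
    with nn have "lev (hd E) \<le> 0" by auto
    then show ?thesis by (intro above_cong) (use d in auto)
  next
    case False
    show ?thesis
    proof (rule above_cong_nonpos)
      have "lev z \<le> 0" if "z \<in> set (us' @ bs')" for z
        using usl'[of z] bsl'[of z] d(7,8) that by auto
      moreover have "us' = [] \<longleftrightarrow> us = []" "bs' = [] \<longleftrightarrow> bs = []" by (simp_all add: us'_def bs'_def)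
      ultimately show "lev (hd (rev us' @ rev bs' @ rev A)) \<le> 0"
        using False d(5) by (auto simp: hd_append hd_rev)
    qed (use d in simp_all)
  qed
  show ?thesis
    using diag_cols us bs ab abE
    by (auto simp: active_cols_def below_append above_append simp flip: bs'_def us'_def)
qed

lemma cfg_notin:
  assumes c: "cfg n k (A, us, y, bs, E)"
  shows "k \<notin> diag_cols A" "k \<notin> diag_cols E" "k \<notin> below_cols A Y" "k \<notin> below_cols bs Y" "k \<notin> below_cols E Y"
    "k \<notin> above_cols Z A" "k \<notin> above_cols Z E"
proof -
  have "k \<notin> fst ` set A" "k \<notin> fst ` set bs" "k \<notin> fst ` set E"
    using cfgD(1,3,4,9)[OF c] by force+
  then show "k \<notin> diag_cols A" "k \<notin> diag_cols E" "k \<notin> below_cols A Y" "k \<notin> below_cols bs Y" "k \<notin> below_cols E Y"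
    "k \<notin> above_cols Z A" "k \<notin> above_cols Z E"
    using below_subset above_subset dia_subset by blast+
qed

text \<open>\<open>W\<close> is the point below \<open>hd E\<close> on the line of slope 1 through
  \<open>(k, y)\<close>. It is inactive itself, as \<open>hd E\<close> follows on a higher level. A
  search coming from \<open>A\<close> either ends no later than \<open>(k, y)\<close> or is on a
  level above \<open>y - k\<close> and passes over \<open>W\<close>.\<close>

lemma toggle_insert:
  assumes c: "cfg n k (A, us, y, bs, E)" and y: "y < k" "y - k < lev (hd E)"
  defines "W \<equiv> (fst (hd E), fst (hd E) + y - k)"
  shows "toggle k (column_path k (A, us, y, bs, W # E)) (column_path k (A, us, y, bs, E))"
    and "cfg n k (A, us, y, bs, W # E)"
proof -
  note d = cfgD[OF c]
  have "lt W z" if "z \<in> set E" for z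
    using cfgD(4)[OF c that] y(2) by (intro ltI(2)) (auto simp: W_def lev_def)
  then show c': "cfg n k (A, us, y, bs, W # E)" using c by (simp add: W_def)
  have W: "lev W = y - k" by (simp add: W_def)
  have bsl: "lev z < y - k" if "z \<in> set bs" for z using c that by simp
  have 1: "below_cols A (us @ (k, y) # bs @ W # E) = below_cols A (us @ (k, y) # bs @ E)"
  proof (rule below_cong)
    fix l :: int
    show "rises_to l (us @ (k, y) # bs @ W # E) = rises_to l (us @ (k, y) # bs @ E)"
    proof (rule ret_append_cong, cases "y - k < l")
      case True
      then show "rises_to l ((k, y) # bs @ W # E) = rises_to l ((k, y) # bs @ E)"
        using W by (simp add: ret_append_skip less_trans[OF bsl])
    qed simp
  qed (rule d)
  have "rises_to (lev W) E = False" using y d(6) W by (cases E) auto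
  then have 2: "below_cols (W # E) [] = below_cols E []" by simp
  have "above_cols (W # [(k, y)]) E = above_cols [(k, y)] E"
    by (rule above_cong_nonpos) (use W y in auto)
  then have 3: "above_cols [(k, y)] (W # E) = above_cols [(k, y)] E" using W y by simp
  have 4: "diag_cols (W # E) = diag_cols E" using W y by simp
  show "toggle k (column_path k (A, us, y, bs, W # E)) (column_path k (A, us, y, bs, E))"
    unfolding toggle_def acts_src[OF c] acts_src[OF c'] 1 2 3 4
    using y W cfg_notin[OF c] by auto
qed

text \<open>Searches leaving \<open>A\<close> are on levels at least \<open>lev (last A)\<close>, so
  they pass over the translated excursion, and they meet \<open>us\<close> on unchanged levels. It
  remains to see that dropping \<open>(k, y)\<close> does not change their outcome.\<close>

lemma toggle_swap:
  assumes c: "cfg n k (A, us, y, bs, E)" and y: "y = k \<or> lev (hd E) = y - k"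
    and nn: "us \<noteq> [] \<or> bs \<noteq> [] \<or> lev (last A) \<le> 0 \<or> lev (hd E) \<le> 0"
  shows "toggle k (column_path k (A, us, y, bs, E)) (skip_path k (A, us, y, bs, E))"
proof -
  note d = cfgD[OF c]
  define bs' where "bs' = map (shift 0 (snd (last A) - y)) bs"
  define us' where "us' = map (shift (fst (hd E) - k) (fst (hd E) - k)) us"
  have bsl: "lev z < y - k" if "z \<in> set bs" for z using c that by simp
  have bsl': "lev z < snd (last A) - k" if "z \<in> set bs'" for z using bsl that by (force simp: bs'_def)
  have rus: "rises_to l (us' @ Y) = rises_to l (us @ Y)" for l Y
    unfolding us'_def by (induction us) auto
  have 1: "below_cols A (us @ (k, y) # bs @ E) = below_cols A (bs' @ us' @ E)"
  proof (rule below_cong)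
    fix l :: int
    assume l: "l < 0" "lev (last A) \<le> l"
    have bl: "lev z < l" if "z \<in> set bs'" for z
      using bsl'[OF that] l d(11) by (simp add: lev_def)
    have "rises_to l ((k, y) # bs @ E) = rises_to l E"
    proof (cases "y - k < l")
      case True
      then show ?thesis using bsl by (simp add: ret_append_skip less_trans[OF bsl])
    next
      \<comment> \<open>Such a search ends at \<open>(k, y)\<close>, or at \<open>hd E\<close> if
        that vertex is dropped. If the levels of the two agree, so do the answers; if
        \<open>y = k\<close>, both overshoot the negative level \<open>l\<close>.\<close>
      case False
      then show ?thesis using y l d(6) d(10) by (cases E) (auto simp: lev_def)
    qed
    then have "rises_to l (us @ (k, y) # bs @ E) = rises_to l (us @ E)" by (rule ret_append_cong)
    then show "rises_to l (us @ (k, y) # bs @ E) = rises_to l (bs' @ us' @ E)"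
      by (simp add: ret_append_skip bl rus)
  qed (rule d)
  show ?thesis
    unfolding toggle_def acts_src[OF c] acts_img[OF c nn, folded bs'_def us'_def] 1
    using y cfg_notin[OF c] by auto
qed

section \<open>Paths weakly below the diagonal at column k\<close>

text \<open>If \<open>y < k\<close>, the return vertex must not be followed by a vertical step; the remaining active
  configurations are matched by \<open>insert_configs\<close>. The last condition excludes the case in which
  dropping \<open>(k, k)\<close> would join two vertices above the diagonal and alter the activity of later columns.\<close>

definition swap_configs :: "int \<Rightarrow> int \<Rightarrow> config set" where
  "swap_configs n k = {(A, us, y, bs, E). cfg n k (A, us, y, bs, E) \<and>
     (y = k \<or> lev (hd E) = y - k \<and> fst (hd (tl E)) \<noteq> fst (hd E)) \<and>
     (us \<noteq> [] \<or> bs \<noteq> [] \<or> lev (last A) \<le> 0 \<or> lev (hd E) \<le> 0)}"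

definition insert_configs :: "int \<Rightarrow> int \<Rightarrow> config set" where
  "insert_configs n k = {(A, us, y, bs, E). cfg n k (A, us, y, bs, E) \<and> y < k \<and> y - k < lev (hd E)}"

fun insert_return :: "int \<Rightarrow> config \<Rightarrow> config" where
  "insert_return k (A, us, y, bs, E) = (A, us, y, bs, (fst (hd E), fst (hd E) + y - k) # E)"

section \<open>The skipping move as a bijection onto paths that jump over column
  \<open>k\<close>\<close>

lemma cfg_tl:
  assumes "cfg n k (A, us, y, bs, E)" "lev (hd E) < 0"
  shows "tl E \<noteq> []"
proof
  assume "tl E = []"
  then have "hd E = last E" using assms by (cases E) auto
  then show False using assms by simp
qed

lemma map_shift_inj: "map (shift a b) X = map (shift a b) Y \<longleftrightarrow> X = Y"
  by (rule inj_map_eq_map) (auto simp: inj_on_def shift_def prod_eq_iff)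

text \<open>This is how a skipping path is decoded. In column \<open>w\<close>, the vertices below
  the diagonal are the moved \<open>us\<close>, together with the return vertex if
  \<open>y < k\<close>. Whether the next vertex is still in column \<open>w\<close> tells
  \<open>y = k\<close> from \<open>y < k\<close>; here the condition on \<open>tl E\<close> in
  \<open>swap_configs\<close> enters.\<close>

lemma swaps_tail:
  assumes t: "(A, us, y, bs, E) \<in> swap_configs n k"
  defines "w \<equiv> fst (hd E)"
  defines "X \<equiv> map (shift (w - k) (w - k)) us @ E" and "P \<equiv> \<lambda>z. fst z = w \<and> lev z < 0"
  shows "fst (hd X) = w" "fst (hd (dropWhile P X)) = w \<longleftrightarrow> y = k"
    "takeWhile P X = map (shift (w - k) (w - k)) us @ (if y = k then [] else [hd E])"
    "dropWhile P X = (if y = k then E else tl E)"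
proof -
  have c: "cfg n k (A, us, y, bs, E)" and y: "y = k \<or> lev (hd E) = y - k \<and> fst (hd (tl E)) \<noteq> w"
    using t by (simp_all add: swap_configs_def w_def del: cfg.simps)
  note d = cfgD[OF c]
  have us: "\<forall>z\<in>set (map (shift (w - k) (w - k)) us). P z"
  proof
    fix z assume "z \<in> set (map (shift (w - k) (w - k)) us)"
    then obtain u where "u \<in> set us" "z = shift (w - k) (w - k) u" by auto
    then show "P z" using d(2)[of u] d(8) by (simp add: P_def lev_def)
  qed
  show "fst (hd X) = w" using d(2)[of "hd us"] unfolding X_def w_def by (cases us) simp_all
  show 1: "takeWhile P X = map (shift (w - k) (w - k)) us @ (if y = k then [] else [hd E])"
    and 2: "dropWhile P X = (if y = k then E else tl E)"
  proof (atomize (full), cases "y = k")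
    case True
    then have "\<not> P (hd E)" using d(10) by (simp add: P_def lev_def)
    then show "takeWhile P X = map (shift (w - k) (w - k)) us @ (if y = k then [] else [hd E]) \<and>
      dropWhile P X = (if y = k then E else tl E)"
      using takeWhile_split[OF us d(6)] True
      by (simp add: X_def)
  next
    case False
    then have hd: "lev (hd E) < 0" using y d(8) by simp
    have X: "X = (map (shift (w - k) (w - k)) us @ [hd E]) @ tl E" using d(6) by (simp add: X_def)
    have "P (hd E)" using hd by (simp add: P_def w_def)
    with us have 1: "\<forall>z\<in>set (map (shift (w - k) (w - k)) us @ [hd E]). P z" by simp
    have 2: "\<not> P (hd (tl E))" using y False by (simp add: P_def)
    show "takeWhile P X = map (shift (w - k) (w - k)) us @ (if y = k then [] else [hd E]) \<and>
      dropWhile P X = (if y = k then E else tl E)"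
      using takeWhile_split[of _ P, OF 1 cfg_tl[OF c hd] 2, folded X] False by simp
  qed
  show "fst (hd (dropWhile P X)) = w \<longleftrightarrow> y = k" using y 2 by (cases "y = k") (simp_all add: w_def)
qed

lemma img_inj: "inj_on (skip_path k) (swap_configs n k)"
proof (rule inj_onI, clarsimp simp del: cfg.simps skip_path.simps)
  fix A us y bs E A' us' y' bs' E'
  assume t: "(A, us, y, bs, E) \<in> swap_configs n k" and t': "(A', us', y', bs', E') \<in> swap_configs n k"
    and eq: "skip_path k (A, us, y, bs, E) = skip_path k (A', us', y', bs', E')"
  have c: "cfg n k (A, us, y, bs, E)" and c': "cfg n k (A', us', y', bs', E')"
    using t t' by (simp_all add: swap_configs_def del: cfg.simps)
  define w w' where "w = fst (hd E)" and "w' = fst (hd E')"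
  define b where "b = snd (last A)"
  define X X' where "X = map (shift (w - k) (w - k)) us @ E"
    and "X' = map (shift (w' - k) (w' - k)) us' @ E'"
  have A: "A = A'" using cfg_img_parts(1)[OF c] cfg_img_parts(1)[OF c'] eq by simp
  have R: "map (shift 0 (b - y)) bs @ X = map (shift 0 (b - y')) bs' @ X'"
    using cfg_img_parts(3)[OF c] cfg_img_parts(3)[OF c'] eq
    by (simp only: X_def X'_def b_def w_def w'_def A)
  \<comment> \<open>The translated excursion is again recognizable as a maximal initial piece, now
    below the level of \<open>(k, b)\<close>, where \<open>b\<close> is the height of the last
    vertex before the column.\<close>
  have *: "takeWhile (\<lambda>z. lev z < b - k) (map (shift 0 (b - y)) bs @ X) = map (shift 0 (b - y)) bs \<and>
     dropWhile (\<lambda>z. lev z < b - k) (map (shift 0 (b - y)) bs @ X) = X"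
    if c: "cfg n k (A, us, y, bs, E)" and b: "b = snd (last A)"
      and X: "X = map (shift (fst (hd E) - k) (fst (hd E) - k)) us @ E" for A us y bs E X
  proof -
    note d = cfgD[OF c]
    have 1: "\<forall>z\<in>set (map (shift 0 (b - y)) bs). lev z < b - k"
    proof
      fix z assume "z \<in> set (map (shift 0 (b - y)) bs)"
      then obtain u where "u \<in> set bs" "z = shift 0 (b - y) u" by auto
      then show "lev z < b - k" using d(3)[of u] by (simp add: lev_def)
    qed
    have 2: "X \<noteq> []" "\<not> lev (hd X) < b - k"
      using d(2)[of "hd us"] d(6,7,10) unfolding X b by (cases us; simp add: lev_def)+
    show ?thesis using takeWhile_split[of "map (shift 0 (b - y)) bs" "\<lambda>z. lev z < b - k", OF 1 2] by simp
  qed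
  note p = *[OF c b_def X_def[unfolded w_def], unfolded R]
    and p' = *[OF c' b_def[unfolded A] X'_def[unfolded w'_def]]
  have bs: "map (shift 0 (b - y)) bs = map (shift 0 (b - y')) bs'"
    by (rule trans[OF sym[OF conjunct1[OF p]] conjunct1[OF p']])
  have X: "X = X'"
    by (rule trans[OF sym[OF conjunct2[OF p]] conjunct2[OF p']])
  have w: "w = w'"
    using swaps_tail(1)[OF t, folded w_def, folded X_def] swaps_tail(1)[OF t', folded w'_def, folded X'_def] X
    by (simp only:)
  define P where "P = (\<lambda>z. fst z = w \<and> lev z < 0)"
  note s = swaps_tail(2-)[OF t, folded w_def, folded X_def P_def]
  note s' = swaps_tail(2-)[OF t', folded w'_def, folded X'_def, folded w X, folded P_def]
  have y: "y = k \<longleftrightarrow> y' = k" by (rule trans[OF sym[OF s(1)] s'(1)])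
  note e2 = trans[OF sym[OF s(2)] s'(2)] and e3 = trans[OF sym[OF s(3)] s'(3)]
  have "us = us' \<and> y = y' \<and> E = E'"
  proof (cases "y = k")
    case True
    then have "y' = k" by (rule y[THEN iffD1])
    with True e2 e3 show ?thesis by (simp add: map_shift_inj)
  next
    case False
    then have "y' \<noteq> k" using y by blast
    with False e2 e3 have 1: "us = us'" "hd E = hd E'" "tl E = tl E'" by (simp_all add: map_shift_inj)
    have "E = E'" using 1(2,3) cfgD(6)[OF c] cfgD(6)[OF c'] by (cases E; cases E') auto
    moreover have "lev (hd E) = y - k" "lev (hd E') = y' - k"
      using t t' False \<open>y' \<noteq> k\<close> by (simp_all add: swap_configs_def del: cfg.simps)
    ultimately show ?thesis using 1(1) by simp
  qed
  then have e: "us = us'" "y = y'" "E = E'" by blast+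
  have "bs = bs'" by (rule bs[unfolded e(2) map_shift_inj])
  with e A show "A = A' \<and> us = us' \<and> y = y' \<and> bs = bs' \<and> E = E'" by blast
qed

text \<open>The configuration is built by running the decoding of \<open>swaps_tail\<close>
  backwards: first split off the translated excursion, then the part of column \<open>w\<close>
  below the diagonal.\<close>

lemma img_surj:
  assumes L: "L \<in> vpaths n" and k: "0 < k" "k < n" and m: "mid k L = []" "snd (last (lo k L)) \<le> k"
    and nn: "\<not> (lev (last (lo k L)) > 0 \<and> lev (hd (hi k L)) > 0)"
  shows "L \<in> skip_path k ` swap_configs n k"
proof -
  define A where "A = lo k L"
  define b where "b = snd (last A)"
  define R where "R = hi k L"
  define bs' where "bs' = takeWhile (\<lambda>z. lev z < b - k) R"
  define X where "X = dropWhile (\<lambda>z. lev z < b - k) R"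
  define w where "w = fst (hd X)"
  define us1 where "us1 = takeWhile (\<lambda>z. fst z = w \<and> lev z < 0) X"
  define E1 where "E1 = dropWhile (\<lambda>z. fst z = w \<and> lev z < 0) X"
  note sp = vpaths_split[OF L k]
  have bk: "b \<le> k" using m by (simp add: b_def A_def)
  have LAR: "L = A @ R" using sp(1) m by (simp add: A_def R_def)
  have RX: "R = bs' @ X" by (simp add: bs'_def X_def)
  have nR: "(n, n) \<in> set R" unfolding R_def using sp(3,5) by (metis last_in_set)
  then have X: "X \<noteq> []" using bk
    by (auto simp: X_def dropWhile_eq_Nil_conv intro!: bexI[of _ "(n, n)"])
  have lX: "last X = (n, n)" using sp(5) RX X by (simp add: R_def)
  have hX: "b - k \<le> lev (hd X)" using hd_dropWhile[of "\<lambda>z. lev z < b - k" R] X by (simp add: X_def)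
  have XE: "X = us1 @ E1" by (simp add: us1_def E1_def)
  have nX: "(n, n) \<in> set X" using lX X by (metis last_in_set)
  then have E1: "E1 \<noteq> []"
    by (auto simp: E1_def dropWhile_eq_Nil_conv intro!: bexI[of _ "(n, n)"])
  have hE1: "\<not> (fst (hd E1) = w \<and> lev (hd E1) < 0)"
    using hd_dropWhile[of "\<lambda>z. fst z = w \<and> lev z < 0" X] E1 by (simp add: E1_def)
  have us1: "fst z = w" "lev z < 0" if "z \<in> set us1" for z
    using that by (auto simp: us1_def dest: set_takeWhileD)
  have s: "sorted_wrt lt (A @ bs' @ us1 @ E1)"
    using L LAR RX XE by (simp add: vpaths_def)
  have Rk: "fst z > k" if "z \<in> set R" for z using that by (simp add: R_def)
  have wk: "w > k" using Rk[of "hd X"] X RX by (simp add: w_def)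
  \<comment> \<open>If column \<open>w\<close> continues after \<open>us1\<close>, it does so on or
    above the diagonal, and the dropped vertex is taken to be \<open>(k, k)\<close>. Otherwise the
    last vertex of \<open>us1\<close> becomes the return vertex, and its level determines
    \<open>y\<close>.\<close>
  define us2 where "us2 = (if fst (hd E1) = w then us1 else butlast us1)"
  define E where "E = (if fst (hd E1) = w then E1 else last us1 # E1)"
  define y where "y = (if fst (hd E1) = w then k else lev (last us1) + k)"
  have us1ne: "us1 \<noteq> []" if "fst (hd E1) \<noteq> w"
    using that XE by (auto simp: w_def)
  have usE: "us1 @ E1 = us2 @ E"
    using us1ne by (auto simp: us2_def E_def)
  have E: "E \<noteq> []" "fst (hd E) = w"
    using E1 us1ne us1 by (auto simp: E_def)
  have hE: "y - k \<le> lev (hd E)" "y \<le> k"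
    using hE1 us1ne us1 by (auto simp: E_def y_def less_imp_le)
  have s2: "sorted_wrt lt (A @ bs' @ us2 @ E)" using s usE by simp
  have us2: "fst z = w" "lev z < y - k" if "z \<in> set us2" for z
  proof -
    have "z \<in> set us1" using that by (auto simp: us2_def split: if_splits dest: in_set_butlastD)
    then show z: "fst z = w" by (rule us1)
    show "lev z < y - k"
    proof (cases "fst (hd E1) = w")
      case True
      then show ?thesis using that us1 by (simp add: us2_def y_def)
    next
      case False
      then have "hd E = last us1" "z \<in> set us2" "fst (last us1) = w"
        using that us1ne us1 by (simp_all add: E_def)
      moreover have "lt z (hd E)" using s2 that E by (simp add: sorted_wrt_append)
      ultimately show ?thesis using False z by (auto simp: y_def lt_def lev_def prod_eq_iff)
    qed
  qed
  have Ane: "A \<noteq> []" "hd A = (0, 0)" using sp(2,4) by (simp_all add: A_def)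
  have Ak: "\<forall>z\<in>set A. fst z < k" by (simp add: A_def)
  have hXE: "hd X = hd (us2 @ E)" using XE usE by simp
  have hb: "b - k \<le> lev z" if "z \<in> set us2 \<or> z = hd E" for z
  proof -
    have "z \<in> set (us2 @ E)" using that E(1) by auto
    moreover have fz: "fst z = w" using that us2(1) E(2) by blast
    moreover have "sorted_wrt lt (us2 @ E)" using s2 by (simp add: sorted_wrt_append)
    ultimately have "snd (hd X) \<le> snd z" using sorted_ge_hd[of "us2 @ E" z] hXE by simp
    then show ?thesis using hX fz by (simp add: lev_def w_def)
  qed
  have by': "b \<le> y"
  proof (cases "fst (hd E1) = w")
    case True
    then show ?thesis using bk by (simp add: y_def)
  next
    case False
    then show ?thesis using hb[of "hd E"] by (simp add: y_def E_def)
  qed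
  define us where "us = map (shift (k - w) (k - w)) us2"
  define bs where "bs = map (shift 0 (y - b)) bs'"
  have so: "sorted_wrt lt A" "sorted_wrt lt us" "sorted_wrt lt bs" "sorted_wrt lt E"
    using s2 by (simp_all add: sorted_wrt_append us_def bs_def sorted_map_shift)
  have us: "\<forall>z\<in>set us. fst z = k \<and> b \<le> snd z \<and> snd z < y"
  proof
    fix z assume "z \<in> set us"
    then obtain u where "u \<in> set us2" "z = shift (k - w) (k - w) u" by (auto simp: us_def)
    then show "fst z = k \<and> b \<le> snd z \<and> snd z < y"
      using us2[of u] hb[of u] by (simp add: lev_def)
  qed
  have bs: "\<forall>z\<in>set bs. k < fst z \<and> fst z \<le> fst (hd E) \<and> y \<le> snd z \<and> lev z < y - k"
  proof -
    have *: "k < fst z \<and> fst z \<le> fst (hd E) \<and> b \<le> snd z \<and> lev z < b - k" if z: "z \<in> set bs'" for z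
    proof -
      have "lt (last A) z" "lt z (hd E)" using s2 Ane z E by (simp_all add: sorted_wrt_append)
      moreover have "lev z < b - k" using z by (auto simp: bs'_def dest: set_takeWhileD)
      moreover have "k < fst z" using z Rk RX by simp
      ultimately show ?thesis by (simp add: lt_def b_def)
    qed
    show ?thesis
    proof
      fix z assume "z \<in> set bs"
      then obtain u where "u \<in> set bs'" "z = shift 0 (y - b) u" by (auto simp: bs_def)
      then show "k < fst z \<and> fst z \<le> fst (hd E) \<and> y \<le> snd z \<and> lev z < y - k"
        using *[of u] by simp
    qed
  qed
  have lE: "last E = (n, n)" using lX XE usE E by simp
  have c: "cfg n k (A, us, y, bs, E)"
    using Ane Ak so us bs E lE hE wk by' by (simp add: b_def)
  have "map (shift (w - k) (w - k)) us = us2" "map (shift 0 (b - y)) bs = bs'"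
    by (simp_all add: us_def bs_def o_def shift_def)
  then have skip_path: "L = skip_path k (A, us, y, bs, E)"
    using LAR RX XE usE E by (simp add: b_def)
  have "lev (hd R) \<le> 0 \<or> lev (last A) \<le> 0" using nn by (auto simp: A_def R_def)
  moreover have "hd R = hd E" if "us = []" "bs = []"
    using that RX XE usE by (simp add: us_def bs_def)
  ultimately have nn': "us \<noteq> [] \<or> bs \<noteq> [] \<or> lev (last A) \<le> 0 \<or> lev (hd E) \<le> 0" by auto
  have "y = k \<or> lev (hd E) = y - k \<and> fst (hd (tl E)) \<noteq> fst (hd E)"
    unfolding E(2) by (auto simp: y_def E_def)
  with c nn' have "(A, us, y, bs, E) \<in> swap_configs n k" by (simp add: swap_configs_def del: cfg.simps)
  with skip_path show ?thesis by blast
qed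

section \<open>Cancellation among the paths weakly below the diagonal at column
  \<open>k\<close>\<close>

definition same_above :: "int \<Rightarrow> ipoint list \<Rightarrow> bool" where
  "same_above k L \<longleftrightarrow> lev (last (lo k L)) > 0 \<and> lev (hd (hi k L)) > 0 \<and> (mid k L = [] \<or> mid k L = [(k, k)])"

text \<open>The excluded paths with \<open>same_above\<close> are covered by \<open>upper\<close>.\<close>

definition lower :: "int \<Rightarrow> int \<Rightarrow> ipoint list set" where
  "lower n k = {L \<in> vpaths n. (if mid k L = [] then snd (last (lo k L)) \<le> k else lev (last (mid k L)) \<le> 0) \<and>
     \<not> same_above k L}"

lemma cfg_sub: "swap_configs n k \<subseteq> {t. cfg n k t}" "insert_configs n k \<subseteq> {t. cfg n k t}"
    "insert_return k ` insert_configs n k \<subseteq> {t. cfg n k t}"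
proof -
  show "swap_configs n k \<subseteq> {t. cfg n k t}" "insert_configs n k \<subseteq> {t. cfg n k t}"
    unfolding swap_configs_def insert_configs_def by blast+
  show "insert_return k ` insert_configs n k \<subseteq> {t. cfg n k t}"
  proof (rule image_subsetI)
    fix t assume "t \<in> insert_configs n k"
    then show "insert_return k t \<in> {t. cfg n k t}"
      by (cases t) (simp add: insert_configs_def toggle_insert(2) del: cfg.simps)
  qed
qed

lemma ins_inj: "inj_on (insert_return k) (insert_configs n k)"
  by (rule inj_onI) (auto simp del: cfg.simps)

text \<open>A vertical step after the return vertex leads to a higher level in the same column, so
  deleting the return vertex gives an overshooting configuration. This inverts
  \<open>insert_return\<close>.\<close>

lemma cfg_tl_cfg:
  assumes c: "cfg n k (A, us, y, bs, E)" and y: "y < k" "lev (hd E) = y - k"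
    and f: "fst (hd (tl E)) = fst (hd E)"
  shows "(A, us, y, bs, tl E) \<in> insert_configs n k" "insert_return k (A, us, y, bs, tl E) = (A, us, y, bs, E)"
proof -
  have tl: "tl E \<noteq> []" using cfg_tl[OF c] y by simp
  have E: "E = hd E # tl E" using cfgD(6)[OF c] by simp
  have "sorted_wrt lt E" "last E = (n, n)" using c by simp_all
  then have s: "lt (hd E) (hd (tl E))" "sorted_wrt lt (tl E)" "last (tl E) = (n, n)"
    using tl by (subst (asm) (1 2) E, simp)+
  have "snd (hd E) < snd (hd (tl E))" using s(1) f by (auto simp: lt_def prod_eq_iff)
  then have l: "y - k < lev (hd (tl E))" using y f by (simp add: lev_def)
  have "cfg n k (A, us, y, bs, tl E)" using c tl s l f by simp
  with l y show "(A, us, y, bs, tl E) \<in> insert_configs n k" by (simp add: insert_configs_def del: cfg.simps)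
  have "(fst (hd E), fst (hd E) + y - k) = hd E" using y by (simp add: lev_def prod_eq_iff)
  then show "insert_return k (A, us, y, bs, tl E) = (A, us, y, bs, E)" using f E by simp
qed

text \<open>A top vertex on the diagonal gives a swap configuration, as \<open>same_above\<close> is
  excluded. Below the diagonal, the excursion overshoots, or returns before a vertical step, or
  returns otherwise; these are the insertion configurations, their images under
  \<open>insert_return\<close>, and swap configurations.\<close>

lemma src_lower:
  assumes "0 < k" "k < n"
  shows "{L \<in> lower n k. mid k L \<noteq> []} = column_path k ` (swap_configs n k \<union> (insert_configs n k \<union> insert_return k ` insert_configs n k))"
proof (intro subset_antisym subsetI)
  fix L assume "L \<in> {L \<in> lower n k. mid k L \<noteq> []}"
  then have L: "L \<in> vpaths n" "mid k L \<noteq> []" "lev (last (mid k L)) \<le> 0" "\<not> same_above k L"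
    by (auto simp: lower_def)
  from cfg_src_surj[OF L(1) assms L(2,3)] obtain t where t: "cfg n k t" "L = column_path k t" by blast
  obtain A us y bs E where te: "t = (A, us, y, bs, E)" by (cases t)
  note c = t(1)[unfolded te]
  note d = cfgD[OF c]
  have "t \<in> swap_configs n k \<union> (insert_configs n k \<union> insert_return k ` insert_configs n k)"
  proof (cases "y = k")
    case True
    have "us \<noteq> [] \<or> bs \<noteq> [] \<or> lev (last A) \<le> 0 \<or> lev (hd E) \<le> 0"
    proof (rule ccontr)
      assume "\<not> ?thesis"
      then have "same_above k L"
        unfolding t(2) te same_above_def cfg_src_parts[OF c] using True by auto
      with L(4) show False ..
    qed
    with True c have "t \<in> swap_configs n k" by (simp add: swap_configs_def te del: cfg.simps)
    then show ?thesis by blast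
  next
    case False
    then have y: "y < k" using d(8) by simp
    have l: "y - k \<le> lev (hd E)" using d(10) by (simp add: lev_def)
    consider "y - k < lev (hd E)" | "lev (hd E) = y - k" "fst (hd (tl E)) = fst (hd E)"
      | "lev (hd E) = y - k" "fst (hd (tl E)) \<noteq> fst (hd E)" using l by linarith
    then show ?thesis
    proof cases
      case 1
      then have "t \<in> insert_configs n k" using y c by (simp add: insert_configs_def te del: cfg.simps)
      then show ?thesis by blast
    next
      case 2
      from cfg_tl_cfg[OF c y 2] have "t \<in> insert_return k ` insert_configs n k" unfolding te by (metis imageI)
      then show ?thesis by blast
    next
      case 3
      then have "t \<in> swap_configs n k" using y c by (simp add: swap_configs_def te del: cfg.simps)
      then show ?thesis by blast
    qed
  qed
  then show "L \<in> column_path k ` (swap_configs n k \<union> (insert_configs n k \<union> insert_return k ` insert_configs n k))" unfolding t(2) by (rule imageI)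
next
  fix L assume "L \<in> column_path k ` (swap_configs n k \<union> (insert_configs n k \<union> insert_return k ` insert_configs n k))"
  then obtain t where t: "L = column_path k t" "t \<in> swap_configs n k \<union> (insert_configs n k \<union> insert_return k ` insert_configs n k)" by (rule imageE)
  obtain A us y bs E where te: "t = (A, us, y, bs, E)" by (cases t)
  have "t \<in> {t. cfg n k t}" using t(2)
    by (elim UnE) (erule subsetD[OF cfg_sub(1)] subsetD[OF cfg_sub(2)] subsetD[OF cfg_sub(3)])+
  then have c: "cfg n k (A, us, y, bs, E)" unfolding te by (rule CollectD)
  note d = cfgD[OF c]
  have nn: "y < k \<or> us \<noteq> [] \<or> bs \<noteq> [] \<or> lev (last A) \<le> 0 \<or> lev (hd E) \<le> 0"
    using t(2) unfolding te by (auto simp: swap_configs_def insert_configs_def simp del: cfg.simps)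
  have "\<not> same_above k L"
  proof
    assume s: "same_above k L"
    then have "us = []" "y = k" "lev (last A) > 0" "lev (hd (bs @ E)) > 0"
      unfolding t(1) te same_above_def cfg_src_parts[OF c] by auto
    \<comment> \<open>With \<open>y = k\<close>, a nonempty excursion would begin below the
      diagonal.\<close>
    moreover from this have "bs = []" using d(3)[of "hd bs"] by (cases bs) (auto simp: lev_def)
    ultimately show False using nn by simp
  qed
  then show "L \<in> {L \<in> lower n k. mid k L \<noteq> []}"
    using cfg_src_vpaths[OF c] cfg_src_parts(2)[OF c] d(8)
    by (simp add: lower_def t(1) te del: column_path.simps)
qed

lemma img_lower:
  assumes "0 < k" "k < n"
  shows "{L \<in> lower n k. mid k L = []} = skip_path k ` swap_configs n k"
proof (intro subset_antisym subsetI)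
  fix L assume "L \<in> {L \<in> lower n k. mid k L = []}"
  then show "L \<in> skip_path k ` swap_configs n k"
    by (intro img_surj assms) (auto simp: lower_def same_above_def)
next
  fix L assume "L \<in> skip_path k ` swap_configs n k"
  then obtain t where t: "L = skip_path k t" "t \<in> swap_configs n k" by (rule imageE)
  obtain A us y bs E where te: "t = (A, us, y, bs, E)" by (cases t)
  have "t \<in> {t. cfg n k t}" using t(2) by (rule subsetD[OF cfg_sub(1)])
  then have c: "cfg n k (A, us, y, bs, E)" unfolding te by (rule CollectD)
  note d = cfgD[OF c]
  note p = cfg_img_parts[OF c]
  have nn: "us \<noteq> [] \<or> bs \<noteq> [] \<or> lev (last A) \<le> 0 \<or> lev (hd E) \<le> 0"
    using t(2) unfolding te by (simp add: swap_configs_def del: cfg.simps)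
  have "\<not> same_above k L"
  proof
    assume "same_above k L"
    then have s: "lev (last A) > 0"
      "lev (hd (map (shift 0 (snd (last A) - y)) bs @ map (shift (fst (hd E) - k) (fst (hd E) - k)) us @ E)) > 0"
      unfolding t(1) te same_above_def p by auto
    then have "bs = []" using d(3)[of "hd bs"] d(7,8) by (cases bs) (auto simp: lev_def)
    moreover from this have "us = []" using s(2) d(2)[of "hd us"] d(7,8) by (cases us) (auto simp: lev_def)
    ultimately show False using nn s by simp
  qed
  then show "L \<in> {L \<in> lower n k. mid k L = []}"
    using cfg_img_vpaths[OF c] p(1,2) d(7,8)
    by (simp add: lower_def t(1) te del: skip_path.simps)
qed

text \<open>Among the paths that meet column \<open>k\<close>, the insertion pairs cancel. The
  remaining ones cancel against the paths that jump over the column.\<close>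

lemma sum_lower:
  assumes k: "0 < k" "k < n" and T: "k \<notin> T" and fin: "finite (vpaths n)"
  shows "sum (weight k T) (lower n k) = 0"
proof -
  let ?S = "swap_configs n k" and ?I = "insert_configs n k" and ?w = "sum (weight k T)"
  have inj: "inj_on (column_path k) (?S \<union> (?I \<union> insert_return k ` ?I))"
    by (rule inj_on_subset[OF cfg_src_inj]) (use cfg_sub in blast)
  have finl: "finite (lower n k)" by (rule finite_subset[OF _ fin]) (auto simp: lower_def)
  have "finite (column_path k ` (?S \<union> (?I \<union> insert_return k ` ?I)))"
    unfolding src_lower[OF k, symmetric] using finl by simp
  then have fins: "finite ?S" "finite ?I" using finite_imageD[OF _ inj] by auto
  have disj: "?S \<inter> (?I \<union> insert_return k ` ?I) = {}" "?I \<inter> insert_return k ` ?I = {}"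
    by (auto simp: swap_configs_def insert_configs_def simp del: cfg.simps)
  have "?w (lower n k) = ?w {L \<in> lower n k. mid k L \<noteq> []} + ?w {L \<in> lower n k. mid k L = []}"
    by (subst sum.union_disjoint[symmetric]) (use finl in \<open>auto intro!: sum.cong\<close>)
  also have "?w {L \<in> lower n k. mid k L \<noteq> []} = sum (weight k T \<circ> column_path k) (?S \<union> (?I \<union> insert_return k ` ?I))"
    unfolding src_lower[OF k] by (rule sum.reindex[OF inj])
  also have "\<dots> = sum (weight k T \<circ> column_path k) ?S + (sum (weight k T \<circ> column_path k) ?I + sum (weight k T \<circ> column_path k) (insert_return k ` ?I))"
    using disj fins by (simp add: sum.union_disjoint)
  also have "sum (weight k T \<circ> column_path k) ?S = ?w (column_path k ` ?S)"
    by (rule sum.reindex[symmetric]) (rule inj_on_subset[OF inj], blast)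
  also have "sum (weight k T \<circ> column_path k) ?I + sum (weight k T \<circ> column_path k) (insert_return k ` ?I) = 0"
  proof -
    have "weight k T (column_path k t) + weight k T (column_path k (insert_return k t)) = 0" if "t \<in> ?I" for t
    proof -
      obtain A us y bs E where te: "t = (A, us, y, bs, E)" by (cases t)
      have "toggle k (column_path k (insert_return k t)) (column_path k t)"
        using that unfolding te insert_return.simps
        by (intro toggle_insert(1)[of n]) (simp_all add: insert_configs_def del: cfg.simps)
      from wt_toggle[OF T this] show ?thesis by simp
    qed
    then show ?thesis by (simp add: sum.reindex[OF ins_inj] flip: sum.distrib)
  qed
  also have "?w (column_path k ` ?S) + 0 + ?w {L \<in> lower n k. mid k L = []} = ?w (column_path k ` ?S) + ?w (skip_path k ` ?S)"
    unfolding img_lower[OF k] by simp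
  also have "\<dots> = 0"
  proof (rule sum_wt_toggle[OF T _ img_inj])
    show "inj_on (column_path k) ?S" by (rule inj_on_subset[OF inj]) blast
    fix t assume t: "t \<in> ?S"
    obtain A us y bs E where te: "t = (A, us, y, bs, E)" by (cases t)
    have "cfg n k (A, us, y, bs, E) \<and> (y = k \<or> lev (hd E) = y - k) \<and>
        (us \<noteq> [] \<or> bs \<noteq> [] \<or> lev (last A) \<le> 0 \<or> lev (hd E) \<le> 0)"
      using t unfolding te swap_configs_def by blast
    then show "toggle k (column_path k t) (skip_path k t)" unfolding te using toggle_swap by blast
  qed
  finally show ?thesis .
qed

section \<open>Rotation and crossing of the diagonal\<close>

lemma ex_split_Cons:
  "(\<exists>X1 z X2. x # X = X1 @ z # X2 \<and> P X1 z X2) \<longleftrightarrow>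
    P [] x X \<or> (\<exists>X1 z X2. X = X1 @ z # X2 \<and> P (x # X1) z X2)"
  by (simp add: Cons_eq_append_conv) blast

lemma below_iff:
  "j \<in> below_cols X Y \<longleftrightarrow> (\<exists>X1 z X2. X = X1 @ z # X2 \<and> fst z = j \<and> lev z < 0 \<and> rises_to (lev z) (X2 @ Y))"
proof (induction X)
  case (Cons x X)
  then show ?case
    unfolding ex_split_Cons[where P = "\<lambda>X1 z X2. fst z = j \<and> lev z < 0 \<and> rises_to (lev z) (X2 @ Y)"]
      below_cols.simps Un_iff
    by (auto simp only: if_True if_False singleton_iff empty_iff split: if_splits)
qed simp

lemma above_iff:
  "j \<in> above_cols Z X \<longleftrightarrow> (\<exists>X1 z X2. X = X1 @ z # X2 \<and> fst z = j \<and> lev z > 0 \<and> falls_to (lev z) (rev X1 @ Z))"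
proof (induction X arbitrary: Z)
  case (Cons x X)
  show ?case
    unfolding ex_split_Cons[where P = "\<lambda>X1 z X2. fst z = j \<and> lev z > 0 \<and> falls_to (lev z) (rev X1 @ Z)"]
      above_cols.simps Un_iff Cons[of "x # Z"] rev.simps append_assoc append_Cons append_Nil
    by (auto simp only: if_True if_False singleton_iff empty_iff split: if_splits)
qed simp

text \<open>This form treats both sides of the diagonal alike, which suits the half turn and the
  translation to step lists.\<close>

lemma acts_iff:
  "j \<in> active_cols L \<longleftrightarrow> (\<exists>X1 z X2. L = X1 @ z # X2 \<and> fst z = j \<and>
     (lev z = 0 \<or> lev z < 0 \<and> rises_to (lev z) X2 \<or> lev z > 0 \<and> falls_to (lev z) (rev X1)))"
proof -
  have "j \<in> diag_cols L \<longleftrightarrow> (\<exists>X1 z X2. L = X1 @ z # X2 \<and> fst z = j \<and> lev z = 0)"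
    unfolding diag_cols_def image_iff Bex_def mem_Collect_eq in_set_conv_decomp by blast
  then show ?thesis unfolding active_cols_def Un_iff below_iff above_iff append_Nil2 by blast
qed

section \<open>The half turn about the centre of the square\<close>

definition refl_pt :: "int \<Rightarrow> ipoint \<Rightarrow> ipoint" where
  "refl_pt n z = (n - fst z, n - snd z)"

definition rot :: "int \<Rightarrow> ipoint list \<Rightarrow> ipoint list" where
  "rot n L = map (refl_pt n) (rev L)"

lemma refl_pt_simps [simp]:
  "fst (refl_pt n z) = n - fst z" "snd (refl_pt n z) = n - snd z" "lev (refl_pt n z) = - lev z"
  "refl_pt n (refl_pt n z) = z" "refl_pt n (x, y) = (n - x, n - y)"
  by (simp_all add: refl_pt_def lev_def)

lemma rot_rot [simp]: "rot n (rot n L) = L"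
  by (simp add: rot_def rev_map o_def)

lemma rot_Nil_iff [simp]: "rot n L = [] \<longleftrightarrow> L = []"
  by (simp add: rot_def)

lemma hd_rot: "L \<noteq> [] \<Longrightarrow> hd (rot n L) = refl_pt n (last L)"
  by (simp add: rot_def hd_map hd_rev)

lemma last_rot: "L \<noteq> [] \<Longrightarrow> last (rot n L) = refl_pt n (hd L)"
  by (simp add: rot_def last_map last_rev)

lemma rot_vpaths: "L \<in> vpaths n \<Longrightarrow> rot n L \<in> vpaths n"
proof -
  assume L: "L \<in> vpaths n"
  have "sorted_wrt lt (rot n L)"
    unfolding rot_def sorted_wrt_map sorted_wrt_rev
    by (rule sorted_wrt_mono_rel[of _ lt]) (use L in \<open>auto simp: vpaths_def lt_def refl_pt_def prod_eq_iff\<close>)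
  with L show ?thesis by (simp add: vpaths_def hd_rot last_rot)
qed

lemma rot_vpaths_iff [simp]: "rot n L \<in> vpaths n \<longleftrightarrow> L \<in> vpaths n"
  using rot_vpaths[of L n] rot_vpaths[of "rot n L" n] by auto

lemma ret_refl: "rises_to l (map (refl_pt n) X) = falls_to (- l) X"
  by (induction X) auto

lemma anc_refl: "falls_to l (map (refl_pt n) X) = rises_to (- l) X"
  by (induction X) auto

text \<open>Reversal exchanges the vertices before and after the tested one, and the point
  reflection negates levels, so the tests below and above the diagonal are exchanged.\<close>

lemma acts_rot_aux: "j \<in> active_cols L \<Longrightarrow> n - j \<in> active_cols (rot n L)"
proof -
  assume "j \<in> active_cols L"
  then obtain X1 z X2 where L: "L = X1 @ z # X2" "fst z = j"
    "lev z = 0 \<or> lev z < 0 \<and> rises_to (lev z) X2 \<or> lev z > 0 \<and> falls_to (lev z) (rev X1)"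
    unfolding acts_iff by blast
  have "rot n L = map (refl_pt n) (rev X2) @ refl_pt n z # map (refl_pt n) (rev X1)"
    by (simp add: rot_def L(1))
  moreover have "fst (refl_pt n z) = n - j" using L(2) by simp
  moreover have "rev (map (refl_pt n) (rev X2)) = map (refl_pt n) X2" by (simp add: rev_map)
  ultimately show ?thesis
    unfolding acts_iff using L(3) by (fastforce simp: ret_refl anc_refl)
qed

lemma acts_rot: "active_cols (rot n L) = (\<lambda>j. n - j) ` active_cols L"
proof (intro subset_antisym subsetI)
  fix j assume "j \<in> active_cols (rot n L)"
  from acts_rot_aux[OF this, of n] show "j \<in> (\<lambda>j. n - j) ` active_cols L" by (auto intro: image_eqI[of _ _ "n - j"])
next
  fix j assume "j \<in> (\<lambda>j. n - j) ` active_cols L"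
  then show "j \<in> active_cols (rot n L)" using acts_rot_aux by blast
qed

lemma wt_rot: "weight k T (rot n L) = weight (n - k) ((\<lambda>j. n - j) ` T) L"
proof -
  have *: "(\<lambda>j. n - j) ` X = Y \<longleftrightarrow> X = (\<lambda>j. n - j) ` Y" for X Y :: "int set"
    by (auto simp: image_image)
  show ?thesis unfolding weight_def acts_rot * by simp
qed

lemma parts_rot:
  "lo k (rot n L) = rot n (hi (n - k) L)" "mid k (rot n L) = rot n (mid (n - k) L)"
  "hi k (rot n L) = rot n (lo (n - k) L)"
  unfolding parts_def rot_def filter_map rev_filter[symmetric]
  by (auto intro!: arg_cong[of _ _ "map (refl_pt n)"] filter_cong)

definition same_below :: "int \<Rightarrow> ipoint list \<Rightarrow> bool" where
  "same_below k L \<longleftrightarrow> lev (last (lo k L)) < 0 \<and> lev (hd (hi k L)) < 0 \<and> (mid k L = [] \<or> mid k L = [(k, k)])"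

definition upper :: "int \<Rightarrow> int \<Rightarrow> ipoint list set" where
  "upper n k = {L \<in> vpaths n. (if mid k L = [] then snd (hd (hi k L)) \<ge> k else lev (hd (mid k L)) \<ge> 0) \<and>
     \<not> same_below k L}"

lemma upper_rot:
  assumes "0 < k" "k < n"
  shows "upper n k = rot n ` lower n (n - k)"
proof -
  have k': "0 < n - k" "n - k < n" using assms by auto
  have *: "rot n L \<in> upper n k \<longleftrightarrow> L \<in> lower n (n - k)" for L
  proof (cases "L \<in> vpaths n")
    case True
    have ne: "lo (n - k) L \<noteq> []" "hi (n - k) L \<noteq> []"
      using vpaths_split(2,3)[OF True k'] by blast+
    have "rot n (mid (n - k) L) = [(k, k)] \<longleftrightarrow> mid (n - k) L = [(n - k, n - k)]"
      by (cases "mid (n - k) L" rule: rev_cases) (auto simp: rot_def refl_pt_def prod_eq_iff)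
    then show ?thesis using True ne
      by (auto simp: upper_def lower_def same_below_def same_above_def parts_rot hd_rot last_rot)
  qed (simp add: upper_def lower_def)
  show ?thesis
  proof (intro subset_antisym subsetI)
    fix L assume "L \<in> upper n k"
    then have "rot n L \<in> lower n (n - k)" using *[of "rot n L"] by simp
    then show "L \<in> rot n ` lower n (n - k)" by (rule rev_image_eqI) simp
  qed (use * in auto)
qed

lemma sum_upper:
  assumes k: "0 < k" "k < n" and T: "k \<notin> T" and fin: "finite (vpaths n)"
  shows "sum (weight k T) (upper n k) = 0"
proof -
  have inj: "inj_on (rot n) X" for X by (rule inj_on_inverseI[of _ "rot n"]) simp
  have "sum (weight k T) (upper n k) = sum (weight (n - k) ((\<lambda>j. n - j) ` T)) (lower n (n - k))"
    unfolding upper_rot[OF k] sum.reindex[OF inj] by (simp add: wt_rot)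
  also have "\<dots> = 0" by (rule sum_lower) (use assms in auto)
  finally show ?thesis .
qed

section \<open>Inserting and deleting the vertex \<open>(k, k)\<close>\<close>

lemma notin_below_nonneg: "(\<And>z. z \<in> set X \<Longrightarrow> fst z = k \<Longrightarrow> lev z \<ge> 0) \<Longrightarrow> k \<notin> below_cols X Y"
  by (fastforce simp: below_iff)

lemma notin_above_nonpos: "(\<And>z. z \<in> set X \<Longrightarrow> fst z = k \<Longrightarrow> lev z \<le> 0) \<Longrightarrow> k \<notin> above_cols Z X"
  by (fastforce simp: above_iff)

text \<open>Column \<open>k\<close> is climbed vertically below \<open>(k, k)\<close>, so each of
  its vertices in \<open>A\<close> is overshot by its immediate successor; for \<open>last A\<close>
  that successor is \<open>hd B\<close>.\<close>

lemma notin_below_vertical: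
  assumes "sorted_wrt lt (A @ [(k, k)])" "B \<noteq> []" "A \<noteq> [] \<Longrightarrow> fst (last A) = k \<Longrightarrow> lev (last A) < lev (hd B)"
  shows "k \<notin> below_cols A B"
  using assms
proof (induction A)
  case (Cons z A)
  have IH: "k \<notin> below_cols A B" by (rule Cons.IH) (use Cons.prems in auto)
  have "\<not> rises_to (lev z) (A @ B)" if "fst z = k"
  proof (cases A)
    case Nil
    then show ?thesis using Cons.prems that by (cases B) auto
  next
    case (Cons v A')
    then have "lt z v" "lt v (k, k)" using Cons.prems by auto
    then have "lev z < lev v" using that by (auto simp: lt_def lev_def prod_eq_iff)
    then show ?thesis using Cons by simp
  qed
  with IH show ?case by auto
qed simp

lemma notin_above_vertical:
  assumes "sorted_wrt lt ((k, k) # B)" "Z \<noteq> []" "B \<noteq> [] \<Longrightarrow> fst (hd B) = k \<Longrightarrow> lev (hd Z) < lev (hd B)"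
  shows "k \<notin> above_cols Z B"
  using assms
proof (induction B arbitrary: Z)
  case (Cons z B)
  have "k \<notin> above_cols (z # Z) B"
  proof (rule Cons.IH)
    assume B: "B \<noteq> []" "fst (hd B) = k"
    then have "lt (k, k) z" "lt z (hd B)" using Cons.prems by auto
    then show "lev (hd (z # Z)) < lev (hd B)" using B by (auto simp: lt_def lev_def prod_eq_iff)
  qed (use Cons.prems in auto)
  moreover have "\<not> falls_to (lev z) Z" if "fst z = k"
    using Cons.prems that by (cases Z) auto
  ultimately show ?case by auto
qed simp

text \<open>For forward searches on negative levels, either both \<open>(k, k)\<close> and
  \<open>hd B\<close> overshoot, or no search gets past \<open>last A\<close>. Backward searches on
  positive levels behave symmetrically. So only column \<open>k\<close> changes.\<close>

lemma toggle_diagonal: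
  assumes s: "sorted_wrt lt (A @ (k, k) # B)" and ne: "A \<noteq> []" "B \<noteq> []"
    and m: "lev (last A) \<le> 0 \<and> 0 \<le> lev (hd B) \<or> 0 \<le> lev (last A) \<and> lev (hd B) \<le> 0"
  shows "toggle k (A @ (k, k) # B) (A @ B)"
proof -
  have A: "lt z (k, k)" if "z \<in> set A" for z using s that by (simp add: sorted_wrt_append)
  have B: "lt (k, k) z" if "z \<in> set B" for z using s that by (simp add: sorted_wrt_append)
  have Al: "lev z < 0" if "z \<in> set A" "fst z = k" for z
    using A[OF that(1)] that(2) by (auto simp: lt_def lev_def prod_eq_iff)
  have Bl: "lev z > 0" if "z \<in> set B" "fst z = k" for z
    using B[OF that(1)] that(2) by (auto simp: lt_def lev_def prod_eq_iff)
  have 1: "below_cols A ((k, k) # B) = below_cols A B"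
    by (rule below_cong) (use m ne in \<open>cases B; auto\<close>)+
  have 2: "above_cols ((k, k) # rev A) B = above_cols (rev A) B"
  proof (rule above_cong)
    fix l :: int assume l: "0 < l" "l \<le> lev (hd B)"
    then show "falls_to l ((k, k) # rev A) = falls_to l (rev A)"
      using m ne by (cases A rule: rev_cases) auto
  qed (rule ne)
  have "k \<notin> diag_cols A" "k \<notin> diag_cols B" using Al Bl by (fastforce simp: diag_cols_def)+
  moreover have "k \<notin> below_cols B []" by (rule notin_below_nonneg) (use Bl in force)
  moreover have "k \<notin> above_cols [] A" by (rule notin_above_nonpos) (use Al in force)
  moreover have "k \<notin> below_cols A B"
  proof (rule notin_below_vertical)
    show "lev (last A) < lev (hd B)" if "fst (last A) = k" using Al[of "last A"] that m ne by auto
  qed (use s ne in \<open>auto simp: sorted_wrt_append\<close>)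
  moreover have "k \<notin> above_cols (rev A) B"
  proof (rule notin_above_vertical)
    show "lev (hd (rev A)) < lev (hd B)" if "fst (hd B) = k"
      using Bl[of "hd B"] that m ne by (auto simp: hd_rev)
  qed (use s ne in \<open>auto simp: sorted_wrt_append\<close>)
  ultimately show ?thesis
    using 1 2 by (auto simp: toggle_def active_cols_def below_append above_append)
qed

fun with_diag :: "int \<Rightarrow> ipoint list \<times> ipoint list \<Rightarrow> ipoint list" where
  "with_diag k (A, B) = A @ (k, k) # B"

fun without_diag :: "ipoint list \<times> ipoint list \<Rightarrow> ipoint list" where
  "without_diag (A, B) = A @ B"

definition opposite :: "ipoint list \<Rightarrow> ipoint list \<Rightarrow> bool" where
  "opposite A B \<longleftrightarrow> lev (last A) \<le> 0 \<and> 0 \<le> lev (hd B) \<or> 0 \<le> lev (last A) \<and> lev (hd B) \<le> 0"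

definition diag_splits :: "int \<Rightarrow> int \<Rightarrow> (ipoint list \<times> ipoint list) set" where
  "diag_splits n k = {(A, B). A \<noteq> [] \<and> B \<noteq> [] \<and> A @ (k, k) # B \<in> vpaths n \<and> opposite A B}"

lemma diag_splits_sorted: "(A, B) \<in> diag_splits n k \<Longrightarrow> sorted_wrt lt (A @ (k, k) # B)"
  by (simp add: diag_splits_def vpaths_def)

lemma diag_splits_without: "(A, B) \<in> diag_splits n k \<Longrightarrow> A @ B \<in> vpaths n"
  by (auto simp: diag_splits_def vpaths_def sorted_wrt_append)

text \<open>The two halves are the vertices before and after \<open>(k, k)\<close> in the order
  \<open>lt\<close>, whether or not \<open>(k, k)\<close> itself is present. This provides left
  inverses for both ways of joining them.\<close>

lemma filter_lt_diag:
  assumes "sorted_wrt lt (A @ (k, k) # B)"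
  shows "filter (\<lambda>z. lt z (k, k)) (A @ B) = A" "filter (\<lambda>z. lt (k, k) z) (A @ B) = B"
    "filter (\<lambda>z. lt z (k, k)) (A @ (k, k) # B) = A" "filter (\<lambda>z. lt (k, k) z) (A @ (k, k) # B) = B"
proof -
  have A: "\<forall>z\<in>set A. lt z (k, k)" and B: "\<forall>z\<in>set B. lt (k, k) z"
    using assms by (simp_all add: sorted_wrt_append)
  have asym: "\<not> lt v u" if "lt u v" for u v using that by (auto simp: lt_def prod_eq_iff)
  have "\<forall>z\<in>set A. \<not> lt (k, k) z" "\<forall>z\<in>set B. \<not> lt z (k, k)" using A B asym by blast+
  then have "filter (\<lambda>z. lt z (k, k)) A = A" "filter (\<lambda>z. lt (k, k) z) A = []"
    "filter (\<lambda>z. lt z (k, k)) B = []" "filter (\<lambda>z. lt (k, k) z) B = B" "\<not> lt (k, k) (k, k)"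
    using A B by (simp_all add: filter_id_conv filter_empty_conv lt_def)
  then show "filter (\<lambda>z. lt z (k, k)) (A @ B) = A" "filter (\<lambda>z. lt (k, k) z) (A @ B) = B"
    "filter (\<lambda>z. lt z (k, k)) (A @ (k, k) # B) = A" "filter (\<lambda>z. lt (k, k) z) (A @ (k, k) # B) = B"
    by simp_all
qed

lemma diag_splits_inj: "inj_on (with_diag k) (diag_splits n k)" "inj_on without_diag (diag_splits n k)"
proof -
  show "inj_on (with_diag k) (diag_splits n k)"
    by (rule inj_on_inverseI[of _ "\<lambda>L. (filter (\<lambda>z. lt z (k, k)) L, filter (\<lambda>z. lt (k, k) z) L)"])
      (clarsimp simp del: filter_append filter.simps simp: filter_lt_diag(3,4)[OF diag_splits_sorted])
  show "inj_on without_diag (diag_splits n k)"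
    by (rule inj_on_inverseI[of _ "\<lambda>L. (filter (\<lambda>z. lt z (k, k)) L, filter (\<lambda>z. lt (k, k) z) L)"])
      (clarsimp simp del: filter_append filter.simps simp: filter_lt_diag(1,2)[OF diag_splits_sorted])
qed

lemma diag_splitsD:
  assumes "t \<in> diag_splits n k"
  shows "with_diag k t \<in> vpaths n" "without_diag t \<in> vpaths n" "toggle k (with_diag k t) (without_diag t)"
    "(k, k) \<in> set (with_diag k t)" "(k, k) \<notin> set (without_diag t)"
proof -
  obtain A B where t: "t = (A, B)" by (cases t)
  note D = assms[unfolded t]
  note s = diag_splits_sorted[OF D]
  show "with_diag k t \<in> vpaths n" using D by (simp add: t diag_splits_def)
  show "without_diag t \<in> vpaths n" using diag_splits_without[OF D] by (simp add: t)
  show "toggle k (with_diag k t) (without_diag t)"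
    using D toggle_diagonal[OF s] by (simp add: t diag_splits_def opposite_def)
  show "(k, k) \<in> set (with_diag k t)" by (simp add: t)
  show "(k, k) \<notin> set (without_diag t)" using s by (auto simp: t sorted_wrt_append lt_def)
qed

lemma diag_splits_balanced:
  assumes T: "k \<notin> T" and fin: "finite (vpaths n)" and D: "D \<subseteq> diag_splits n k"
  shows "sum (weight k T) (with_diag k ` D \<union> without_diag ` D) = 0"
proof -
  have "with_diag k ` D \<subseteq> vpaths n" "without_diag ` D \<subseteq> vpaths n"
    using D diag_splitsD(1,2) by blast+
  then have f: "finite (with_diag k ` D)" "finite (without_diag ` D)"
    using finite_subset[OF _ fin] by blast+
  have "with_diag k ` D \<inter> without_diag ` D = {}"
  proof (rule equals0I)
    fix L assume L: "L \<in> with_diag k ` D \<inter> without_diag ` D"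
    then obtain t u where tu: "t \<in> D" "L = with_diag k t" "u \<in> D" "L = without_diag u" by blast
    show False
      using diag_splitsD(4)[OF subsetD[OF D tu(1)]] diag_splitsD(5)[OF subsetD[OF D tu(3)]]
      unfolding tu(2)[symmetric] tu(4)[symmetric] by blast
  qed
  then have "sum (weight k T) (with_diag k ` D \<union> without_diag ` D) =
      sum (weight k T) (with_diag k ` D) + sum (weight k T) (without_diag ` D)"
    using f by (simp add: sum.union_disjoint)
  also have "\<dots> = 0"
  proof (rule sum_wt_toggle[OF T])
    show "inj_on (with_diag k) D" "inj_on without_diag D"
      using diag_splits_inj D by (blast intro: inj_on_subset)+
    fix t assume "t \<in> D"
    then show "toggle k (with_diag k t) (without_diag t)" using D diag_splitsD(3) by blast
  qed
  finally show ?thesis .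
qed

definition crossing :: "int \<Rightarrow> int \<Rightarrow> ipoint list set" where
  "crossing n k = {L \<in> vpaths n. mid k L \<noteq> [] \<and> lev (hd (mid k L)) < 0 \<and> 0 < lev (last (mid k L))}"

lemma sorted_insert_diag:
  assumes "sorted_wrt lt (A @ B)" "A \<noteq> []" "B \<noteq> []" "lt (last A) (k, k)" "lt (k, k) (hd B)"
  shows "sorted_wrt lt (A @ (k, k) # B)"
proof -
  have s: "sorted_wrt lt A" "sorted_wrt lt B" using assms by (simp_all add: sorted_wrt_append)
  have "lt z (k, k)" if "z \<in> set A" for z
    using sorted_le_last[OF s(1) that] assms(4) by (auto simp: lt_def prod_eq_iff)
  moreover have "lt (k, k) z" if "z \<in> set B" for z
    using sorted_ge_hd[OF s(2) that] assms(5) by (auto simp: lt_def prod_eq_iff)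
  ultimately show ?thesis using assms(1) by (simp add: sorted_wrt_append)
qed

text \<open>If the column is met at all, its top is not above and its bottom not below the diagonal,
  so it consists of \<open>(k, k)\<close> only. Excluding \<open>same_above\<close> and
  \<open>same_below\<close> is what puts the two neighbours on weakly opposite sides.\<close>

lemma lower_upper:
  assumes k: "0 < k" "k < n"
  defines "D \<equiv> {(A, B) \<in> diag_splits n k. fst (last A) < k \<and> k < fst (hd B)}"
  shows "lower n k \<inter> upper n k = with_diag k ` D \<union> without_diag ` D"
proof (intro subset_antisym subsetI)
  fix L assume "L \<in> lower n k \<inter> upper n k"
  then have L: "L \<in> vpaths n" "\<not> same_above k L" "\<not> same_below k L"
    "mid k L = [] \<Longrightarrow> snd (last (lo k L)) \<le> k \<and> k \<le> snd (hd (hi k L))"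
    "mid k L \<noteq> [] \<Longrightarrow> lev (last (mid k L)) \<le> 0 \<and> 0 \<le> lev (hd (mid k L))"
    by (auto simp: lower_def upper_def split: if_splits)
  note sp = vpaths_split[OF L(1) k]
  define A B where "A = lo k L" and "B = hi k L"
  note sp = sp[folded A_def B_def] and L = L[unfolded same_above_def same_below_def, folded A_def B_def]
  have s: "sorted_wrt lt L" using L(1) by (simp add: vpaths_def)
  have AB: "fst (last A) < k" "k < fst (hd B)"
    using last_in_set[OF sp(2)] hd_in_set[OF sp(3)] unfolding A_def B_def set_parts by blast+
  have opp: "opposite A B" if "mid k L = [] \<or> mid k L = [(k, k)]"
    using that L(2,3) unfolding opposite_def by linarith
  show "L \<in> with_diag k ` D \<union> without_diag ` D"
  proof (cases "mid k L = []")
    case True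
    have LL: "L = A @ B" by (rule sp(1)[unfolded True append_Nil])
    have "sorted_wrt lt (A @ B)" by (rule s[unfolded LL])
    \<comment> \<open>The jump over the column starts at height at most \<open>k\<close> and ends at
      height at least \<open>k\<close>, so \<open>(k, k)\<close> fits in between.\<close>
    moreover have "lt (last A) (k, k)" "lt (k, k) (hd B)"
      using AB L(4)[OF True] by (auto intro!: ltI(1))
    ultimately have "sorted_wrt lt (A @ (k, k) # B)" using sp(2,3) by (intro sorted_insert_diag)
    then have "A @ (k, k) # B \<in> vpaths n"
      using sp(2-) by (simp add: vpaths_def)
    then have "(A, B) \<in> D" using opp True AB sp(2,3) by (simp add: D_def diag_splits_def)
    then show ?thesis using LL by (intro UnI2) (rule image_eqI[of _ _ "(A, B)"], simp)
  next
    case False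
    have sm: "sorted_wrt lt (mid k L)" using s unfolding mid_def by (rule sorted_wrt_filter)
    have hl: "snd (hd (mid k L)) \<le> snd (last (mid k L))"
      using sorted_le_last[OF sm hd_in_set[OF False]] by simp
    have c: "fst (hd (mid k L)) = k" "fst (last (mid k L)) = k"
      using hd_in_set[OF False] last_in_set[OF False] unfolding set_parts by blast+
    have "lev (hd (mid k L)) = 0" "lev (last (mid k L)) = 0"
      using hl c L(5)[OF False] by (simp_all add: lev_def)
    then have e: "hd (mid k L) = (k, k)" "last (mid k L) = (k, k)" using c by (simp_all add: lev_def prod_eq_iff)
    have m: "mid k L = [(k, k)]"
    proof (cases "mid k L")
      case (Cons z m)
      have "m = []"
      proof (rule ccontr)
        assume m: "m \<noteq> []"
        have "\<forall>x\<in>set m. lt z x" using sm Cons by simp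
        then have "lt z (last m)" using last_in_set[OF m] by blast
        moreover have "last m = z" using e Cons m by simp
        ultimately show False by (simp add: lt_def)
      qed
      then show ?thesis using e Cons by simp
    qed (use False in simp)
    have LL: "L = A @ (k, k) # B" by (rule sp(1)[unfolded m append_Cons append_Nil])
    then have "(A, B) \<in> D" using opp m AB sp(2,3) L(1)[unfolded LL] by (simp add: D_def diag_splits_def)
    then show ?thesis using LL by (intro UnI1) (rule image_eqI[of _ _ "(A, B)"], simp)
  qed
next
  fix L assume "L \<in> with_diag k ` D \<union> without_diag ` D"
  then obtain A B where D: "(A, B) \<in> D" and L: "L = A @ (k, k) # B \<or> L = A @ B" by auto
  have ds: "(A, B) \<in> diag_splits n k" and AB: "fst (last A) < k" "k < fst (hd B)" using D by (auto simp: D_def)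
  have ne: "A \<noteq> []" "B \<noteq> []" and opp: "opposite A B" and v: "A @ (k, k) # B \<in> vpaths n"
    using ds by (auto simp: diag_splits_def)
  note s = diag_splits_sorted[OF ds]
  have sAB: "sorted_wrt lt A" "sorted_wrt lt B" "lt (last A) (k, k)" "lt (k, k) (hd B)"
    using s ne by (simp_all add: sorted_wrt_append)
  have Ak: "fst z < k" if "z \<in> set A" for z using sorted_le_last[OF sAB(1) that] AB by simp
  have Bk: "k < fst z" if "z \<in> set B" for z using sorted_ge_hd[OF sAB(2) that] AB by simp
  have p: "lo k (A @ [(k, k)] @ B) = A" "mid k (A @ [(k, k)] @ B) = [(k, k)]" "hi k (A @ [(k, k)] @ B) = B"
    by (rule parts_eqI; use Ak Bk in auto)+
  have p': "lo k (A @ [] @ B) = A" "mid k (A @ [] @ B) = []" "hi k (A @ [] @ B) = B"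
    by (rule parts_eqI; use Ak Bk in auto)+
  have "snd (last A) \<le> k" "k \<le> snd (hd B)" using sAB(3,4) by (simp_all add: lt_def)
  then show "L \<in> lower n k \<inter> upper n k"
    using L v diag_splits_without[OF ds] p p' opp
    by (auto simp: lower_def upper_def same_above_def same_below_def opposite_def)
qed

text \<open>Here the neighbours of \<open>(k, k)\<close> lie in column \<open>k\<close> itself: the
  last vertex below and the first vertex above the diagonal. They are on opposite sides
  automatically.\<close>

lemma crossing_eq:
  assumes k: "0 < k" "k < n"
  defines "D \<equiv> {(A, B) \<in> diag_splits n k. fst (last A) = k \<and> fst (hd B) = k}"
  shows "crossing n k = with_diag k ` D \<union> without_diag ` D"
proof (intro subset_antisym subsetI)
  fix L assume "L \<in> crossing n k"
  then have L: "L \<in> vpaths n" "mid k L \<noteq> []" "lev (hd (mid k L)) < 0" "0 < lev (last (mid k L))"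
    by (auto simp: crossing_def)
  note sp = vpaths_split[OF L(1) k]
  define A B where "A = lo k L" and "B = hi k L"
  note sp = sp[folded A_def B_def]
  have s: "sorted_wrt lt L" using L(1) by (simp add: vpaths_def)
  define m1 m2 where "m1 = takeWhile (\<lambda>z. lev z < 0) (mid k L)" and "m2 = dropWhile (\<lambda>z. lev z < 0) (mid k L)"
  have m: "mid k L = m1 @ m2" by (simp add: m1_def m2_def)
  have m1: "m1 \<noteq> []" using L(2,3) by (cases "mid k L") (auto simp: m1_def)
  have m2: "m2 \<noteq> []"
  proof
    assume "m2 = []"
    then have "\<forall>z\<in>set (mid k L). lev z < 0"
      by (simp add: m2_def dropWhile_eq_Nil_conv del: set_parts)
    from bspec[OF this last_in_set[OF L(2)]] L(4) show False by simp
  qed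
  have "\<not> lev (hd m2) < 0" using hd_dropWhile[of "\<lambda>z. lev z < 0" "mid k L"] m2 by (simp add: m2_def)
  then have h2: "0 \<le> lev (hd m2)" by simp
  have "last m1 \<in> set m1" using m1 by simp
  then have l1: "lev (last m1) < 0" unfolding m1_def by (auto dest: set_takeWhileD)
  have col: "fst z = k" if "z \<in> set m1 \<or> z \<in> set m2" for z
  proof -
    have "z \<in> set (mid k L)" unfolding m using that by simp
    then show ?thesis by simp
  qed
  have LL: "L = (A @ m1) @ m2 @ B" using sp(1)[unfolded m] by simp
  show "L \<in> with_diag k ` D \<union> without_diag ` D"
  proof (cases "lev (hd m2) = 0")
    case True
    then have h: "hd m2 = (k, k)" using col[of "hd m2"] m2 by (simp add: lev_def prod_eq_iff)
    then obtain m3 where m2': "m2 = (k, k) # m3" using m2 by (cases m2) auto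
    have "last m2 = last (mid k L)" using m m2 by simp
    with L(4) have "lev (last m2) \<noteq> 0" by simp
    then have t: "m3 \<noteq> []" using m2' by auto
    have e: "L = (A @ m1) @ (k, k) # (m3 @ B)" by (rule LL[unfolded m2' append_Cons])
    have "hd (m3) \<in> set m2" using t by (simp add: m2')
    then have 1: "fst (hd (m3)) = k" using col by blast
    have "lt (k, k) (hd (m3))" using s[unfolded e] t by (simp add: sorted_wrt_append)
    then have 2: "0 \<le> lev (hd (m3))" using 1 by (simp add: lt_def lev_def)
    have "(A @ m1, m3 @ B) \<in> D"
      using L(1)[unfolded e] t m1 1 2 l1 col[of "last m1"]
      by (simp add: D_def diag_splits_def opposite_def)
    then show ?thesis by (intro UnI1 image_eqI[of _ _ "(A @ m1, m3 @ B)"]) (simp_all add: e)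
  next
    case False
    have "lt (last m1) (k, k)" "lt (k, k) (hd m2)"
      using col[of "last m1"] col[of "hd m2"] m1 m2 l1 h2 False by (auto simp: lev_def intro!: ltI(2))
    then have "sorted_wrt lt ((A @ m1) @ (k, k) # (m2 @ B))"
      using s[unfolded LL] m1 m2 by (intro sorted_insert_diag) simp_all
    then have "(A @ m1) @ (k, k) # (m2 @ B) \<in> vpaths n"
      using sp(2-) by (simp add: vpaths_def)
    then have "(A @ m1, m2 @ B) \<in> D"
      using m1 m2 h2 l1 col[of "last m1"] col[of "hd m2"]
      by (simp add: D_def diag_splits_def opposite_def)
    then show ?thesis using LL by (intro UnI2 image_eqI[of _ _ "(A @ m1, m2 @ B)"]) simp_all
  qed
next
  fix L assume "L \<in> with_diag k ` D \<union> without_diag ` D"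
  then obtain A B where D: "(A, B) \<in> D" and L: "L = A @ (k, k) # B \<or> L = A @ B" by auto
  have ds: "(A, B) \<in> diag_splits n k" and AB: "fst (last A) = k" "k = fst (hd B)" using D by (auto simp: D_def)
  have ne: "A \<noteq> []" "B \<noteq> []" and v: "A @ (k, k) # B \<in> vpaths n"
    using ds by (auto simp: diag_splits_def)
  note s = diag_splits_sorted[OF ds]
  have sAB: "sorted_wrt lt A" "sorted_wrt lt B" "lt (last A) (k, k)" "lt (k, k) (hd B)"
    using s ne by (simp_all add: sorted_wrt_append)
  have lv: "lev (last A) < 0" "0 < lev (hd B)"
    using sAB(3,4) AB by (auto simp: lt_def lev_def prod_eq_iff)
  have sL: "sorted_wrt lt L" and vL: "L \<in> vpaths n" and i: "last A \<in> set L" "hd B \<in> set L"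
    using L s ne v diag_splits_without[OF ds] by (auto simp: sorted_wrt_append)
  have mm: "last A \<in> set (mid k L)" "hd B \<in> set (mid k L)" using i AB by auto
  then have ne': "mid k L \<noteq> []" by (metis empty_iff empty_set)
  have sm: "sorted_wrt lt (mid k L)" using sL unfolding mid_def by (rule sorted_wrt_filter)
  have c: "fst (hd (mid k L)) = k" "fst (last (mid k L)) = k"
    using hd_in_set[OF ne'] last_in_set[OF ne'] unfolding set_parts by blast+
  have "lev (hd (mid k L)) < 0" "0 < lev (last (mid k L))"
    using sorted_ge_hd[OF sm mm(1)] sorted_le_last[OF sm mm(2)] c lv AB by (simp_all add: lev_def)
  then show "L \<in> crossing n k" using vL ne' by (simp add: crossing_def)
qed

text \<open>Inclusion-exclusion for \<open>lower\<close> and \<open>upper\<close>, with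
  \<open>crossing\<close> disjoint from both. The sums over the two sets, over their intersection
  and over \<open>crossing\<close> all vanish.\<close>

lemma sum_vpaths:
  assumes k: "0 < k" "k < n" and T: "k \<notin> T" and fin: "finite (vpaths n)"
  shows "sum (weight k T) (vpaths n) = 0"
proof -
  let ?w = "sum (weight k T)"
  have U: "vpaths n = (lower n k \<union> upper n k) \<union> crossing n k"
  proof (intro subset_antisym subsetI)
    fix L assume L: "L \<in> vpaths n"
    note sp = vpaths_split[OF L k]
    have AB: "fst (last (lo k L)) < k" "k < fst (hd (hi k L))"
      using last_in_set[OF sp(2)] hd_in_set[OF sp(3)] unfolding set_parts by blast+
    have "sorted_wrt lt (lo k L @ mid k L @ hi k L)" using L sp(1) by (simp add: vpaths_def)
    then have "lt (last (lo k L)) (hd (hi k L))" using sp(2,3)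
      by (simp add: sorted_wrt_append del: set_parts)
    then show "L \<in> (lower n k \<union> upper n k) \<union> crossing n k"
      using L AB
      by (auto simp: lower_def upper_def crossing_def same_above_def same_below_def lt_def lev_def)
  qed (auto simp: lower_def upper_def crossing_def)
  have fin': "finite (lower n k)" "finite (upper n k)" "finite (crossing n k)"
    using fin U by (metis finite_Un)+
  have "crossing n k \<inter> (lower n k \<union> upper n k) = {}"
    by (auto simp: lower_def upper_def crossing_def)
  then have "?w (vpaths n) = ?w (lower n k \<union> upper n k) + ?w (crossing n k)"
    using fin' unfolding U by (intro sum.union_disjoint) auto
  moreover have "?w (lower n k \<union> upper n k) + ?w (lower n k \<inter> upper n k) = ?w (lower n k) + ?w (upper n k)"
    by (rule sum.union_inter) (use fin' in auto)
  moreover have "?w (lower n k \<inter> upper n k) = 0"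
    unfolding lower_upper[OF k] by (rule diag_splits_balanced[OF T fin]) blast
  moreover have "?w (crossing n k) = 0"
    unfolding crossing_eq[OF k] by (rule diag_splits_balanced[OF T fin]) blast
  ultimately show ?thesis using sum_lower[OF k T fin] sum_upper[OF k T fin] by simp
qed

section \<open>Step lists and vertex lists\<close>

definition ipt :: "point \<Rightarrow> ipoint" where "ipt V = (int (fst V), int (snd V))"

lemma ipt_simps [simp]: "fst (ipt V) = int (fst V)" "snd (ipt V) = int (snd V)"
  by (simp_all add: ipt_def)

lemma lev_ipt: "lev (ipt V) = int (snd V) - int (fst V)"
  by (simp add: lev_def)

fun vlist :: "point \<Rightarrow> lpath \<Rightarrow> ipoint list" where
  "vlist V [] = [ipt V]"
| "vlist V (s # p) = ipt V # vlist (V + s) p"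

lemma vlist_ne [simp]: "vlist V p \<noteq> []"
  by (cases p) auto

lemma hd_vlist: "hd (vlist V p) = ipt V"
  by (cases p) auto

lemma last_vlist: "last (vlist V p) = ipt (V + sum_list p)"
  by (induction p arbitrary: V) (auto simp: add.assoc)

lemma vlist_snoc: "vlist V (p @ [s]) = vlist V p @ [ipt (V + sum_list p + s)]"
  by (induction p arbitrary: V) (auto simp: add.assoc)

lemma vlist_append: "vlist V (p @ q) = butlast (vlist V p) @ vlist (V + sum_list p) q"
  by (induction p arbitrary: V) (auto simp: add.assoc)

lemma vlist_ge: "z \<in> set (vlist V p) \<Longrightarrow> fst (ipt V) \<le> fst z \<and> snd (ipt V) \<le> snd z"
  by (induction p arbitrary: V) force+

lemma sorted_vlist: "general_lattice_path p \<Longrightarrow> sorted_wrt lt (vlist V p)"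
proof (induction p arbitrary: V)
  case (Cons s p)
  then have s: "s \<noteq> (0, 0)" "general_lattice_path p" by (auto simp: general_lattice_path_def)
  have "lt (ipt V) z" if "z \<in> set (vlist (V + s) p)" for z
    using vlist_ge[OF that] s(1) by (cases s) (auto simp: lt_def prod_eq_iff)
  then show ?case using Cons.IH[OF s(2)] by simp
qed simp

lemma vlist_inj: "vlist V p = vlist V q \<Longrightarrow> p = q"
proof (induction p arbitrary: V q)
  case Nil
  then show ?case by (cases q) (auto simp: vlist_ne[symmetric] simp del: vlist_ne)
next
  case (Cons s p)
  then obtain t q' where q: "q = t # q'" by (cases q) auto
  have e: "vlist (V + s) p = vlist (V + t) q'" using Cons.prems q by simp
  then have "ipt (V + s) = ipt (V + t)" by (metis hd_vlist)
  then have "s = t" by (simp add: ipt_def prod_eq_iff)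
  with e Cons.IH q show ?case by simp
qed

lemma vlist_surj:
  assumes "L \<noteq> []" "hd L = ipt V" "sorted_wrt lt L"
  shows "\<exists>p. general_lattice_path p \<and> vlist V p = L"
  using assms
proof (induction L arbitrary: V)
  case (Cons a L)
  show ?case
  proof (cases "L = []")
    case True
    then show ?thesis using Cons.prems by (intro exI[of _ "[]"]) (auto simp: general_lattice_path_def)
  next
    case False
    define s where "s = (nat (fst (hd L) - fst a), nat (snd (hd L) - snd a))"
    have lt: "lt (ipt V) (hd L)" and a: "a = ipt V" using Cons.prems False by simp_all
    have hd: "hd L = ipt (V + s)" using lt by (auto simp: s_def a lt_def prod_eq_iff)
    have s: "s \<noteq> (0, 0)" using lt hd by (auto simp: lt_def ipt_def)
    obtain p where "general_lattice_path p" "vlist (V + s) p = L"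
      using Cons.IH[OF False hd] Cons.prems by auto
    then show ?thesis using s a by (intro exI[of _ "s # p"]) (auto simp: general_lattice_path_def)
  qed
qed simp

lemma vlist_bij: "bij_betw (vlist (0, 0)) (general_paths n) (vpaths (int n))"
proof (rule bij_betw_imageI)
  show "inj_on (vlist (0, 0)) (general_paths n)" using vlist_inj by (auto intro: inj_onI)
  have ipt: "ipt (0, 0) = (0, 0)" "ipt V = (int n, int n) \<longleftrightarrow> V = (n, n)" for V
    by (auto simp: ipt_def prod_eq_iff)
  have zero: "(0, 0) + V = V" for V :: point by (simp add: prod_eq_iff)
  show "vlist (0, 0) ` general_paths n = vpaths (int n)"
  proof (intro subset_antisym subsetI)
    fix L assume "L \<in> vlist (0, 0) ` general_paths n"
    then show "L \<in> vpaths (int n)"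
      by (auto simp: general_paths_def vpaths_def hd_vlist last_vlist ipt zero intro: sorted_vlist)
  next
    fix L assume L: "L \<in> vpaths (int n)"
    then obtain p where p: "general_lattice_path p" "vlist (0, 0) p = L"
      using vlist_surj[of L "(0, 0)"] by (auto simp: vpaths_def ipt)
    have "last L = (int n, int n)" using L by (simp add: vpaths_def)
    then have "sum_list p = (n, n)"
      using last_vlist[of "(0, 0)" p] unfolding p(2) zero ipt(2)[symmetric] by simp
    with p show "L \<in> vlist (0, 0) ` general_paths n" by (auto simp: general_paths_def)
  qed
qed

section \<open>Search tests compared with balanced subdiagonal and superdiagonal subpaths\<close>

text \<open>A prefix that ends on level \<open>l\<close> without exceeding it need not stop at the
  first return, but its first vertex not below \<open>l\<close> must already be on level
  \<open>l\<close>.\<close>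

lemma ret_vlist:
  "rises_to l (vlist W q) \<longleftrightarrow>
    (\<exists>q1 q2. q = q1 @ q2 \<and> lev (ipt (W + sum_list q1)) = l \<and> (\<forall>z\<in>set (vlist W q1). lev z \<le> l))"
proof (induction q arbitrary: W)
  case Nil
  then show ?case by auto
next
  case (Cons s q)
  let ?P = "\<lambda>q1 q2. lev (ipt (W + sum_list q1)) = l \<and> (\<forall>z\<in>set (vlist W q1). lev z \<le> l)"
  have split: "(\<exists>q1 q2. s # q = q1 @ q2 \<and> ?P q1 q2) \<longleftrightarrow>
      ?P [] (s # q) \<or> (\<exists>q1 q2. q = q1 @ q2 \<and> ?P (s # q1) q2)"
    by (simp only: Cons_eq_append_conv) blast
  have P: "?P (s # q1) q2 \<longleftrightarrow> lev (ipt W) \<le> l \<and>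
      lev (ipt (W + s + sum_list q1)) = l \<and> (\<forall>z\<in>set (vlist (W + s) q1). lev z \<le> l)" for q1 q2
    by (auto simp: add.assoc)
  have Nil: "?P [] (s # q) \<longleftrightarrow> lev (ipt W) = l" by auto
  show ?case unfolding split P Nil vlist.simps rises_to.simps Cons.IH
    by (cases "lev (ipt W)" l rule: linorder_cases) (simp_all add: add.assoc)
qed

lemma anc_vlist:
  "falls_to l (rev (vlist W q)) \<longleftrightarrow>
    (\<exists>q1 q2. q = q1 @ q2 \<and> lev (ipt (W + sum_list q1)) = l \<and>
      (\<forall>z\<in>set (vlist (W + sum_list q1) q2). l \<le> lev z))"
proof (induction q rule: rev_induct)
  case Nil
  then show ?case by auto
next
  case (snoc s q)
  let ?e = "ipt (W + sum_list (q @ [s]))"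
  let ?P = "\<lambda>q1 q2. lev (ipt (W + sum_list q1)) = l \<and> (\<forall>z\<in>set (vlist (W + sum_list q1) q2). l \<le> lev z)"
  have rv: "rev (vlist W (q @ [s])) = ?e # rev (vlist W q)" by (simp add: vlist_snoc add.assoc)
  have split: "(\<exists>q1 q2. q @ [s] = q1 @ q2 \<and> ?P q1 q2) \<longleftrightarrow>
      ?P (q @ [s]) [] \<or> (\<exists>q1 q2. q = q1 @ q2 \<and> ?P q1 (q2 @ [s]))"
  proof
    assume "\<exists>q1 q2. q @ [s] = q1 @ q2 \<and> ?P q1 q2"
    then obtain q1 q2 where q: "q @ [s] = q1 @ q2" and P: "?P q1 q2" by blast
    show "?P (q @ [s]) [] \<or> (\<exists>q1 q2. q = q1 @ q2 \<and> ?P q1 (q2 @ [s]))"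
    proof (cases q2 rule: rev_cases)
      case Nil
      then have "q1 = q @ [s]" using q by simp
      then show ?thesis using P Nil by blast
    next
      case (snoc q3 t)
      then have "q = q1 @ q3" "t = s" using q by simp_all
      then show ?thesis using P snoc by blast
    qed
  next
    assume "?P (q @ [s]) [] \<or> (\<exists>q1 q2. q = q1 @ q2 \<and> ?P q1 (q2 @ [s]))"
    then show "\<exists>q1 q2. q @ [s] = q1 @ q2 \<and> ?P q1 q2" by (metis append.assoc append_Nil2)
  qed
  have last: "?P q1 (q2 @ [s]) \<longleftrightarrow> ?P q1 q2 \<and> l \<le> lev ?e" if "q = q1 @ q2" for q1 q2
    using that by (simp add: vlist_snoc add.assoc conj_ac)
  have "?P (q @ [s]) [] \<longleftrightarrow> lev ?e = l" by auto
  moreover have "(\<exists>q1 q2. q = q1 @ q2 \<and> ?P q1 (q2 @ [s])) \<longleftrightarrow>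
      (\<exists>q1 q2. q = q1 @ q2 \<and> ?P q1 q2) \<and> l \<le> lev ?e"
    using last by blast
  ultimately show ?case unfolding rv split falls_to.simps snoc.IH
    by (cases "lev ?e" l rule: linorder_cases) simp_all
qed

lemma convex_below: "convex {(x, y). y \<le> x + (c::real)}" "convex {(x, y). y \<ge> x + (c::real)}"
proof -
  have "{(x, y). y \<le> x + c} = {p. (-1, 1) \<bullet> p \<le> c}" "{(x, y). y \<ge> x + c} = {p. (-1, 1) \<bullet> p \<ge> c}"
    by auto
  then show "convex {(x, y). y \<le> x + c}" "convex {(x, y). y \<ge> x + c}"
    by (simp_all add: convex_halfspace_le convex_halfspace_ge)
qed

text \<open>A segment lies in a convex set as soon as its endpoints do. For half-planes this reduces
  the conditions on the drawn path to its vertices.\<close>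

lemma path_trace_subset:
  assumes "convex H"
  shows "path_trace W q \<subseteq> H \<longleftrightarrow> (\<forall>z\<in>set (vlist W q). (of_int (fst z), of_int (snd z)) \<in> H)"
proof (induction q arbitrary: W)
  case Nil
  then show ?case by (simp add: real_point_def)
next
  case (Cons s q)
  have seg: "closed_segment a b \<subseteq> H \<longleftrightarrow> a \<in> H \<and> b \<in> H" for a b
    using assms by (meson closed_segment_subset ends_in_segment subset_iff)
  have hd: "hd (vlist (W + s) q) \<in> set (vlist (W + s) q)" by simp
  show ?case
    using bspec[OF _ hd, of "\<lambda>z. (of_int (fst z), of_int (snd z)) \<in> H"]
    by (auto simp: seg Cons.IH hd_vlist real_point_def)
qed

lemma subdiagonal_iff: "subdiagonal V q \<longleftrightarrow> (\<forall>z\<in>set (vlist V q). lev z \<le> lev (ipt V))"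
proof -
  have "subdiagonal V q \<longleftrightarrow> path_trace V q \<subseteq> {(x, y). y \<le> x + (real (snd V) - real (fst V))}"
    by (auto simp: subdiagonal_def diagonal_def algebra_simps)
  also have "\<dots> \<longleftrightarrow> (\<forall>z\<in>set (vlist V q). real_of_int (snd z) \<le> real_of_int (fst z) + (real (snd V) - real (fst V)))"
    by (simp add: path_trace_subset[OF convex_below(1)])
  also have "\<dots> \<longleftrightarrow> (\<forall>z\<in>set (vlist V q). lev z \<le> lev (ipt V))"
    by (intro ball_cong refl) (simp only: lev_def ipt_simps, linarith)
  finally show ?thesis .
qed

lemma superdiagonal_iff: "superdiagonal V q \<longleftrightarrow> (\<forall>z\<in>set (vlist V q). lev (ipt V) \<le> lev z)"
proof -
  have "superdiagonal V q \<longleftrightarrow> path_trace V q \<subseteq> {(x, y). y \<ge> x + (real (snd V) - real (fst V))}"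
    by (auto simp: superdiagonal_def diagonal_def algebra_simps)
  also have "\<dots> \<longleftrightarrow> (\<forall>z\<in>set (vlist V q). real_of_int (snd z) \<ge> real_of_int (fst z) + (real (snd V) - real (fst V)))"
    by (simp add: path_trace_subset[OF convex_below(2)])
  also have "\<dots> \<longleftrightarrow> (\<forall>z\<in>set (vlist V q). lev (ipt V) \<le> lev z)"
    by (intro ball_cong refl) (simp only: lev_def ipt_simps, linarith)
  finally show ?thesis .
qed

lemma balanced_iff: "balanced V q \<longleftrightarrow> lev (ipt (V + sum_list q)) = lev (ipt V)"
  by (simp add: balanced_def real_point_def terminal_vertex_def diagonal_def lev_def)

text \<open>Taking \<open>tl\<close> removes \<open>V\<close> from the search, which corresponds to
  the subpath being nonempty.\<close>

lemma ret_iff: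
  "rises_to (lev (ipt V)) (tl (vlist V p)) \<longleftrightarrow>
    (\<exists>q r. p = q @ r \<and> q \<noteq> [] \<and> balanced V q \<and> subdiagonal V q)"
proof (cases p)
  case (Cons s p')
  have "(\<exists>q r. p = q @ r \<and> q \<noteq> [] \<and> balanced V q \<and> subdiagonal V q) \<longleftrightarrow>
    (\<exists>q r. p' = q @ r \<and> balanced V (s # q) \<and> subdiagonal V (s # q))"
    unfolding Cons by (simp only: Cons_eq_append_conv) blast
  then show ?thesis
    by (simp add: Cons ret_vlist balanced_iff subdiagonal_iff add.assoc)
qed simp

lemma anc_iff:
  "falls_to (lev (ipt (W + sum_list p))) (rev (butlast (vlist W p))) \<longleftrightarrow>
    (\<exists>r q. p = r @ q \<and> q \<noteq> [] \<and> balanced (W + sum_list r) q \<and> superdiagonal (W + sum_list r) q)"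
proof (cases p rule: rev_cases)
  case (snoc p' s)
  let ?V = "W + sum_list p"
  have "(\<exists>r q. p = r @ q \<and> q \<noteq> [] \<and> balanced (W + sum_list r) q \<and> superdiagonal (W + sum_list r) q) \<longleftrightarrow>
    (\<exists>r q. p' = r @ q \<and> balanced (W + sum_list r) (q @ [s]) \<and> superdiagonal (W + sum_list r) (q @ [s]))"
    (is "(\<exists>r q. ?P r q) \<longleftrightarrow> (\<exists>r q. ?Q r q)")
  proof
    assume "\<exists>r q. ?P r q"
    then obtain r q where P: "?P r q" by blast
    then obtain q' t where q: "q = q' @ [t]" by (cases q rule: rev_cases) auto
    with P snoc have "p' = r @ q'" "t = s" by simp_all
    with P q show "\<exists>r q. ?Q r q" by blast
  next
    assume "\<exists>r q. ?Q r q"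
    then show "\<exists>r q. ?P r q" unfolding snoc by (metis append.assoc append_is_Nil_conv not_Cons_self2)
  qed
  also have "\<dots> \<longleftrightarrow> (\<exists>r q. p' = r @ q \<and> lev (ipt (W + sum_list r)) = lev (ipt ?V) \<and>
      (\<forall>z\<in>set (vlist (W + sum_list r) q). lev (ipt ?V) \<le> lev z))"
  proof -
    have "?Q r q \<longleftrightarrow> p' = r @ q \<and> lev (ipt (W + sum_list r)) = lev (ipt ?V) \<and>
      (\<forall>z\<in>set (vlist (W + sum_list r) q). lev (ipt ?V) \<le> lev z)" for r q
    proof (cases "p' = r @ q")
      case True
      then have e: "W + sum_list r + sum_list (q @ [s]) = ?V" "W + sum_list r + sum_list q + s = ?V"
        by (simp_all add: snoc add.assoc)
      show ?thesis unfolding balanced_iff superdiagonal_iff e vlist_snoc using True by auto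
    qed simp
    then show ?thesis by blast
  qed
  finally show ?thesis by (simp add: snoc vlist_snoc anc_vlist)
qed simp

text \<open>Cutting the step list makes \<open>z\<close> both the last vertex of one piece and the
  first of the other; \<open>butlast\<close> and \<open>tl\<close> remove these copies.\<close>

lemma vlist_split_iff:
  "vlist W p = X1 @ z # X2 \<longleftrightarrow> (\<exists>p1 p2. p = p1 @ p2 \<and> X1 = butlast (vlist W p1) \<and>
     z = ipt (W + sum_list p1) \<and> X2 = tl (vlist (W + sum_list p1) p2))"
proof
  assume "vlist W p = X1 @ z # X2"
  then show "\<exists>p1 p2. p = p1 @ p2 \<and> X1 = butlast (vlist W p1) \<and>
     z = ipt (W + sum_list p1) \<and> X2 = tl (vlist (W + sum_list p1) p2)"
  proof (induction X1 arbitrary: W p)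
    case Nil
    then show ?case
      by (intro exI[of _ "[]"] exI[of _ p]) (use hd_vlist[of W p] in simp)
  next
    case (Cons x X1)
    then obtain s p' where p: "p = s # p'" by (cases p) auto
    with Cons.prems have x: "x = ipt W" "vlist (W + s) p' = X1 @ z # X2" by simp_all
    from Cons.IH[OF x(2)] obtain p1 p2 where "p' = p1 @ p2" "X1 = butlast (vlist (W + s) p1)"
      "z = ipt (W + s + sum_list p1)" "X2 = tl (vlist (W + s + sum_list p1) p2)" by blast
    then show ?case using p x
      by (intro exI[of _ "s # p1"] exI[of _ p2]) (simp add: add.assoc)
  qed
next
  assume "\<exists>p1 p2. p = p1 @ p2 \<and> X1 = butlast (vlist W p1) \<and>
     z = ipt (W + sum_list p1) \<and> X2 = tl (vlist (W + sum_list p1) p2)"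
  then obtain p1 p2 where p: "p = p1 @ p2" "X1 = butlast (vlist W p1)"
     "z = ipt (W + sum_list p1)" "X2 = tl (vlist (W + sum_list p1) p2)" by blast
  have "vlist (W + sum_list p1) p2 = z # X2"
    using hd_vlist[of "W + sum_list p1" p2] list.collapse[OF vlist_ne, of "W + sum_list p1" p2]
    by (simp add: p(3,4))
  then show "vlist W p = X1 @ z # X2" by (simp add: p(1,2) vlist_append)
qed

lemma active_line_iff: "active_line p k \<longleftrightarrow> int k \<in> active_cols (vlist (0, 0) p)"
proof -
  have zero: "(0, 0) + V = V" for V :: point by (simp add: prod_eq_iff)
  define dn up where "dn = (\<lambda>p1 p2. \<exists>q r. p2 = q @ r \<and> q \<noteq> [] \<and> balanced (sum_list p1) q \<and> subdiagonal (sum_list p1) q)"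
    and "up = (\<lambda>p1. \<exists>r q. p1 = r @ q \<and> q \<noteq> [] \<and> balanced (sum_list r) q \<and> superdiagonal (sum_list r) q)"
  let ?C = "\<lambda>p1 p2. fst (sum_list p1) = k \<and> (snd (sum_list p1) = fst (sum_list p1) \<or>
      snd (sum_list p1) < fst (sum_list p1) \<and> dn p1 p2 \<or> snd (sum_list p1) > fst (sum_list p1) \<and> up p1)"
  have "int k \<in> active_cols (vlist (0, 0) p) \<longleftrightarrow> (\<exists>p1 p2. p = p1 @ p2 \<and> fst (ipt (sum_list p1)) = int k \<and>
      (lev (ipt (sum_list p1)) = 0 \<or> lev (ipt (sum_list p1)) < 0 \<and> dn p1 p2 \<or>
       lev (ipt (sum_list p1)) > 0 \<and> up p1))"
    unfolding acts_iff vlist_split_iff dn_def up_def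
      ret_iff[symmetric] anc_iff[of "(0, 0)", unfolded zero, symmetric] zero
    by blast
  also have "\<dots> \<longleftrightarrow> (\<exists>p1 p2. p = p1 @ p2 \<and> ?C p1 p2)"
    by (simp add: lev_ipt)
  also have "\<dots> \<longleftrightarrow> active_line p k"
  proof
    assume "\<exists>p1 p2. p = p1 @ p2 \<and> ?C p1 p2"
    then obtain p1 p2 where p: "p = p1 @ p2" and C: "?C p1 p2" by blast
    have V: "sum_list p1 \<in> vertices p"
      unfolding vertices_def p by (intro CollectI exI[of _ "length p1"]) simp
    have "\<exists>q. subpath_at p (sum_list p1) q \<and> q \<noteq> [] \<and> balanced (sum_list p1) q \<and> subdiagonal (sum_list p1) q"
      if "dn p1 p2" using that unfolding dn_def subpath_at_def p by blast
    moreover have "\<exists>U q. subpath_at p U q \<and> terminal_vertex U q = sum_list p1 \<and> q \<noteq> [] \<and>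
        balanced U q \<and> superdiagonal U q" if "up p1"
    proof -
      from that obtain r q where q: "p1 = r @ q" "q \<noteq> []" "balanced (sum_list r) q" "superdiagonal (sum_list r) q"
        unfolding up_def by blast
      have "subpath_at p (sum_list r) q" unfolding subpath_at_def p q(1) by (metis append.assoc)
      then show ?thesis using q by (metis sum_list_append terminal_vertex_def)
    qed
    ultimately show "active_line p k" unfolding active_line_def using V C by blast
  next
    assume "active_line p k"
    then obtain V where V: "V \<in> vertices p" "fst V = k" and
      "snd V = fst V \<or> snd V < fst V \<and>
          (\<exists>q. subpath_at p V q \<and> q \<noteq> [] \<and> balanced V q \<and> subdiagonal V q)
      \<or> snd V > fst V \<and>
          (\<exists>U q. subpath_at p U q \<and> terminal_vertex U q = V \<and>
             q \<noteq> [] \<and> balanced U q \<and> superdiagonal U q)"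
      unfolding active_line_def by blast
    then consider "snd V = fst V"
      | q where "snd V < fst V" "subpath_at p V q" "q \<noteq> []" "balanced V q" "subdiagonal V q"
      | U q where "snd V > fst V" "subpath_at p U q" "terminal_vertex U q = V" "q \<noteq> []"
        "balanced U q" "superdiagonal U q"
      by blast
    then show "\<exists>p1 p2. p = p1 @ p2 \<and> ?C p1 p2"
    proof cases
      case 1
      from V(1) obtain i where "V = sum_list (take i p)" unfolding vertices_def by blast
      then show ?thesis using V(2) 1 by (intro exI[of _ "take i p"] exI[of _ "drop i p"]) simp
    next
      case 2
      then obtain p1 p2 where p: "p = p1 @ q @ p2" "V = sum_list p1" unfolding subpath_at_def by blast
      have "dn p1 (q @ p2)" unfolding dn_def using 2 p(2) by blast
      then show ?thesis using p V(2) 2(1) by blast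
    next
      case 3
      then obtain p1 p2 where p: "p = p1 @ q @ p2" "U = sum_list p1" unfolding subpath_at_def by blast
      have s: "sum_list (p1 @ q) = V" using 3(3) p(2) by (simp add: terminal_vertex_def)
      have "up (p1 @ q)" unfolding up_def using 3 p(2) by blast
      then show ?thesis using s p(1) V(2) 3(1)
        by (intro exI[of _ "p1 @ q"] exI[of _ p2]) (simp del: sum_list_append)
    qed
  qed
  finally show ?thesis by simp
qed

section \<open>Transfer of the count to active sets\<close>

text \<open>The endpoints of the path are on the diagonal, so columns 0 and \<open>n\<close> always
  belong to \<open>active_cols\<close>, while \<open>active_set\<close> records interior columns
  only.\<close>

lemma active_set_eq_iff:
  assumes n: "n \<ge> 1" and p: "p \<in> general_paths n" and S: "S \<subseteq> {1..n - 1}"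
  shows "active_set n p = S \<longleftrightarrow> active_cols (vlist (0, 0) p) = int ` S \<union> {0, int n}"
proof -
  have L: "vlist (0, 0) p \<in> vpaths (int n)" using p vlist_bij[of n] by (auto simp: bij_betw_def)
  then have s: "sorted_wrt lt (vlist (0, 0) p)" "hd (vlist (0, 0) p) = (0, 0)" "last (vlist (0, 0) p) = (int n, int n)"
    by (simp_all add: vpaths_def)
  have ends: "(0, 0) \<in> set (vlist (0, 0) p)" "(int n, int n) \<in> set (vlist (0, 0) p)"
    using hd_in_set[OF vlist_ne, of "(0, 0)" p] last_in_set[OF vlist_ne, of "(0, 0)" p] s(2,3) by simp_all
  have "0 \<in> diag_cols (vlist (0, 0) p)" "int n \<in> diag_cols (vlist (0, 0) p)"
    using ends by (force simp: diag_cols_def)+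
  then have e: "0 \<in> active_cols (vlist (0, 0) p)" "int n \<in> active_cols (vlist (0, 0) p)" by (simp_all add: active_cols_def)
  have "0 \<le> j \<and> j \<le> int n" if "j \<in> active_cols (vlist (0, 0) p)" for j
  proof -
    from that obtain z where "z \<in> set (vlist (0, 0) p)" "j = fst z" using acts_subset by blast
    then show ?thesis
      using sorted_le_last[OF s(1), of z] sorted_ge_hd[OF s(1), of z] s(2,3) by simp
  qed
  then have sub: "active_cols (vlist (0, 0) p) \<subseteq> {0..int n}" by auto
  have A: "active_cols (vlist (0, 0) p) = int ` active_set n p \<union> {0, int n}"
  proof (intro subset_antisym subsetI)
    fix j assume j: "j \<in> active_cols (vlist (0, 0) p)"
    then have "0 \<le> j" "j \<le> int n" using sub by auto
    then obtain k where k: "j = int k" "k \<le> n" by (metis nonneg_int_cases of_nat_le_iff)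
    then show "j \<in> int ` active_set n p \<union> {0, int n}"
      using j by (cases "k = 0 \<or> k = n") (auto simp: active_set_def active_line_iff)
  next
    fix j assume "j \<in> int ` active_set n p \<union> {0, int n}"
    then show "j \<in> active_cols (vlist (0, 0) p)" using e by (auto simp: active_set_def active_line_iff)
  qed
  have "active_set n p \<subseteq> {1..n - 1}" by (auto simp: active_set_def)
  moreover have "X = Y" if "int ` X \<union> {0, int n} = int ` Y \<union> {0, int n}"
    "X \<subseteq> {1..n - 1}" "Y \<subseteq> {1..n - 1}" for X Y :: "nat set"
  proof -
    have *: "X = {k \<in> {1..n - 1}. int k \<in> int ` X \<union> {0, int n}}" if "X \<subseteq> {1..n - 1}" for X
      using that n by auto
    have "X = {k \<in> {1..n - 1}. int k \<in> int ` X \<union> {0, int n}}" by (rule *[OF that(2)])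
    also have "\<dots> = Y" unfolding that(1) by (rule *[OF that(3), symmetric])
    finally show ?thesis .
  qed
  ultimately show ?thesis unfolding A using S by blast
qed

lemma card_active_set:
  assumes "n \<ge> 1" "S \<subseteq> {1..n - 1}"
  shows "card {p \<in> general_paths n. active_set n p = S} =
    card {L \<in> vpaths (int n). active_cols L = int ` S \<union> {0, int n}}"
proof (rule bij_betw_same_card)
  let ?P = "\<lambda>L. active_cols L = int ` S \<union> {0, int n}"
  have e: "{p \<in> general_paths n. active_set n p = S} = {p \<in> general_paths n. ?P (vlist (0, 0) p)}"
    using active_set_eq_iff[OF assms(1) _ assms(2)] by (intro Collect_cong conj_cong refl)
  have i: "f ` {p \<in> G. P (f p)} = {L \<in> f ` G. P L}" for f :: "lpath \<Rightarrow> ipoint list" and G P by blast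
  show "bij_betw (vlist (0, 0)) {p \<in> general_paths n. active_set n p = S} {L \<in> vpaths (int n). ?P L}"
    unfolding e
  proof (rule bij_betw_subset[OF vlist_bij[of n]])
    show "vlist (0, 0) ` {p \<in> general_paths n. ?P (vlist (0, 0) p)} = {L \<in> vpaths (int n). ?P L}"
      using i[of "vlist (0, 0)" "general_paths n" ?P]
      unfolding bij_betw_imp_surj_on[OF vlist_bij[of n]] .
  qed (rule Collect_restrict)
qed

text \<open>The total weight is the difference of the two cardinalities, and it vanishes by
  \<open>sum_vpaths\<close>.\<close>

lemma card_insert_active:
  assumes n: "n \<ge> 1" and S: "S \<subseteq> {1..n - 1}" and k: "k \<in> {1..n - 1}" "k \<notin> S"
  shows "card {p \<in> general_paths n. active_set n p = insert k S} =
    card {p \<in> general_paths n. active_set n p = S}"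
proof -
  let ?T = "int ` S \<union> {0, int n}" and ?V = "vpaths (int n)"
  have fin: "finite ?V"
    using bij_betw_finite[OF vlist_bij[of n]] finite_general_paths[of n] by simp
  have kT: "int k \<notin> ?T" using k n by auto
  have count: "card {L \<in> ?V. P L} = sum (\<lambda>L. of_bool (P L) :: int) ?V" for P :: "ipoint list \<Rightarrow> bool"
    using fin by (simp add: Int_def)
  have "0 = sum (weight (int k) ?T) ?V"
    by (rule sum_vpaths[symmetric]) (use k n kT fin in auto)
  also have "\<dots> = int (card {L \<in> ?V. active_cols L = insert (int k) ?T}) - int (card {L \<in> ?V. active_cols L = ?T})"
    unfolding weight_def by (simp only: sum_subtractf count)
  finally have "card {L \<in> ?V. active_cols L = insert (int k) ?T} = card {L \<in> ?V. active_cols L = ?T}" by simp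
  moreover have "insert (int k) ?T = int ` insert k S \<union> {0, int n}" by blast
  ultimately show ?thesis
    using card_active_set[OF n S] card_active_set[OF n, of "insert k S"] S k by simp
qed

theorem theorem1:
  fixes n :: nat and S T :: "nat set"
  assumes "n \<ge> 1"
    and "S \<subseteq> {1..n - 1}" and "T \<subseteq> {1..n - 1}"
  shows "card {p \<in> general_paths n. active_set n p = S} =
         card {p \<in> general_paths n. active_set n p = T}"
proof -
  \<comment> \<open>Every set is compared with the empty one by adding its elements one at a
    time.\<close>
  have "card {p \<in> general_paths n. active_set n p = S} = card {p \<in> general_paths n. active_set n p = {}}"
    if "S \<subseteq> {1..n - 1}" for S
  proof -
    have "finite S" using that by (rule finite_subset) simp
    then show ?thesis using that
    proof (induction S rule: finite_induct)
      case (insert k S)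
      then show ?case using card_insert_active[OF assms(1), of S k] by simp
    qed simp
  qed
  from this[OF assms(2)] this[OF assms(3)] show ?thesis by simp
qed

end
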